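(* The exact classical communication cost of simulating quantum communication satisfies $$C_{\mathrm{cl}}(4)=\infty .$$ Consequently, $C_{\mathrm{cl}}(d_Q)=\infty$ for every integer $d_Q\ge 4$. (That is, for every $d_Q\ge4$ there is no $d_C\in\mathbb N$ such that $d_Q$-dimensional quantum communication admits a classical simulation with classical message dimension $d_C$.)
   Context: Notation: $[n]=\{1,\dots,n\}$; $\mathbb{1}_d$ is the identity on $\mathbb C^d$; $A\succeq 0$ means positive semidefinite. The set of quantum states is $\mathcal S_d=\{\rho\in\mathbb C^{d\times d}:\rho=\rho^\dagger,\ \rho\succeq0,\ \operatorname{tr}\rho=1\}$. The set of $n$-outcome POVMs is $\mathcal M_{d,n}=\{(M_1,\dots,M_n): M_b=M_b^\dagger\in\mathbb C^{d\times d},\ M_b\succeq0,\ \sum_{b=1}^nM_b=\mathbb{1}_d\}$. Both are compact subsets of finite-dimensional real vector spaces and carry their Borel $\sigma$-algebras $\mathcal B(\mathcal S_d)$, $\mathcal B(\mathcal M_{d,n})$. Definition (classical simulation of quantum communication). Fix $d_Q,d_C\in\mathbb N$. We say that $d_Q$-dimensional quantum communication admits a classical simulation with classical message dimension $d_C$ if there exist: (1) a probability space $(\Lambda,\Sigma_\Lambda,\mu)$ (shared randomness); (2) an encoder, i.e. numbers $p_A(c\mid\rho,\lambda)\ge0$ for $c\in[d_C]$, $\rho\in\mathcal S_{d_Q}$, $\lambda\in\Lambda$ with $\sum_{c=1}^{d_C}p_A(c\mid\rho,\lambda)=1$; and, for every $n\ge1$, a decoder, i.e. numbers $p_B(b\mid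 M,c,\lambda)\ge0$ for $b\in[n]$, $M\in\mathcal M_{d_Q,n}$, $c\in[d_C]$, $\lambda\in\Lambda$ with $\sum_{b=1}^np_B(b\mid M,c,\lambda)=1$; (3) such that for every $c$ the map $(\rho,\lambda)\mapsto p_A(c\mid\rho,\lambda)$ is $\mathcal B(\mathcal S_{d_Q})\otimes\Sigma_\Lambda$-measurable, and for every $n,c,b$ the map $(M,\lambda)\mapsto p_B(b\mid M,c,\lambda)$ is $\mathcal B(\mathcal M_{d_Q,n})\otimes\Sigma_\Lambda$-measurable; (4) and such that for every $n\ge1$, $\rho\in\mathcal S_{d_Q}$, $M\in\mathcal M_{d_Q,n}$ and $b\in[n]$, $$\operatorname{tr}(\rho M_b)=\int_\Lambda\sum_{c=1}^{d_C}p_A(c\mid\rho,\lambda)\,p_B(b\mid M,c,\lambda)\,d\mu(\lambda).$$ The classical communication cost is $C_{\mathrm{cl}}(d_Q)=\inf\{d_C\in\mathbb N:\ d_Q\text{-dimensional quantum communication admits a classical simulation with message dimension }d_C\}$, with $C_{\mathrm{cl}}(d_Q)=\infty$ if this set is empty. *)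

theory Defs
  imports "HOL-Probability.Probability" "HOL-Library.Extended_Nat"
begin

text \<open>
  Complex \<open>d \<times> d\<close> matrices are rendered as \<^typ>\<open>complex^'d^'d\<close> with \<open>d = CARD('d)\<close>; this type carries
  the usual topology of a finite-dimensional real vector space, so \<^const>\<open>borel\<close> on it is the
  usual Borel \<open>\<sigma>\<close>-algebra.
\<close>

definition adjoint_mat :: "complex^'n^'m \<Rightarrow> complex^'m^'n" where
  "adjoint_mat A = (\<chi> i j. cnj (A $ j $ i))"

definition hermitian_mat :: "complex^'d^'d \<Rightarrow> bool" where
  "hermitian_mat A \<longleftrightarrow> adjoint_mat A = A"

text \<open>
  The sum is \<open>v\<^sup>\<dagger> A v\<close>. It is automatically real when \<open>A\<close> is Hermitian, which is always
  required alongside positive semidefiniteness below.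
\<close>

definition psd_mat :: "complex^'d^'d \<Rightarrow> bool" where
  "psd_mat A \<longleftrightarrow> (\<forall>v :: complex^'d. 0 \<le> Re (\<Sum>i\<in>UNIV. cnj (v $ i) * (A *v v) $ i))"

definition quantum_states :: "(complex^'d^'d) set" where
  "quantum_states = {\<rho>. hermitian_mat \<rho> \<and> psd_mat \<rho> \<and> trace \<rho> = 1}"

text \<open>
  A tuple \<open>(M\<^sub>1, \<dots>, M\<^sub>n)\<close> is a function on \<^typ>\<open>nat\<close> that vanishes outside \<open>{1..n}\<close>. With the
  product topology on the function type, the resulting set is homeomorphic to the set of
  \<open>n\<close>-tuples of matrices, so restricting \<^const>\<open>borel\<close> to it gives its Borel \<open>\<sigma>\<close>-algebra.
  Padding identifies an \<open>n\<close>-outcome POVM with an \<open>(n+1)\<close>-outcome one, which is why decoders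
  below take \<open>n\<close> as a separate argument.
\<close>

definition povms :: "nat \<Rightarrow> (nat \<Rightarrow> complex^'d^'d) set" where
  "povms n = {M. (\<forall>b\<in>{1..n}. hermitian_mat (M b) \<and> psd_mat (M b)) \<and>
                 (\<Sum>b\<in>{1..n}. M b) = mat 1 \<and> (\<forall>b. b \<notin> {1..n} \<longrightarrow> M b = 0)}"

text \<open>
  In the following, \<open>pA c \<rho> l\<close> is \<open>p\<^sub>A(c | \<rho>, \<lambda>)\<close> and \<open>pB n b M c l\<close> is \<open>p\<^sub>B(b | M, c, \<lambda>)\<close> for
  \<open>n\<close>-outcome POVMs \<open>M\<close>; only arguments in the stated ranges matter.
\<close>

definition is_encoder ::
  "nat \<Rightarrow> 'l measure \<Rightarrow> (nat \<Rightarrow> complex^'d^'d \<Rightarrow> 'l \<Rightarrow> real) \<Rightarrow> bool" where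
  "is_encoder dC L pA \<longleftrightarrow>
     (\<forall>\<rho>\<in>quantum_states. \<forall>l\<in>space L.
        (\<forall>c\<in>{1..dC}. 0 \<le> pA c \<rho> l) \<and> (\<Sum>c\<in>{1..dC}. pA c \<rho> l) = 1) \<and>
     (\<forall>c\<in>{1..dC}. (\<lambda>(\<rho>, l). pA c \<rho> l)
        \<in> borel_measurable (restrict_space borel quantum_states \<Otimes>\<^sub>M L))"

definition is_decoder ::
  "nat \<Rightarrow> 'l measure \<Rightarrow> nat \<Rightarrow> (nat \<Rightarrow> (nat \<Rightarrow> complex^'d^'d) \<Rightarrow> nat \<Rightarrow> 'l \<Rightarrow> real) \<Rightarrow> bool" where
  "is_decoder dC L n pB \<longleftrightarrow>
     (\<forall>M\<in>povms n. \<forall>c\<in>{1..dC}. \<forall>l\<in>space L.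
        (\<forall>b\<in>{1..n}. 0 \<le> pB b M c l) \<and> (\<Sum>b\<in>{1..n}. pB b M c l) = 1) \<and>
     (\<forall>c\<in>{1..dC}. \<forall>b\<in>{1..n}. (\<lambda>(M, l). pB b M c l)
        \<in> borel_measurable (restrict_space borel (povms n) \<Otimes>\<^sub>M L))"

text \<open>
  HOL cannot quantify over types inside a formula, so the type \<open>'l\<close> in which the sample space
  \<open>\<Lambda>\<close> lives is a parameter. A statement that there is no simulation is to be read for
  every type \<open>'l\<close>. The integrand below is bounded and measurable on a probability space, so
  the Bochner integral is never taken by default to be 0.
\<close>

definition admits_simulation :: "'l itself \<Rightarrow> 'd::finite itself \<Rightarrow> nat \<Rightarrow> bool" where
  "admits_simulation _ _ dC \<longleftrightarrow>
     (\<exists>(L :: 'l measure) (pA :: nat \<Rightarrow> complex^'d^'d \<Rightarrow> 'l \<Rightarrow> real)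
       (pB :: nat \<Rightarrow> nat \<Rightarrow> (nat \<Rightarrow> complex^'d^'d) \<Rightarrow> nat \<Rightarrow> 'l \<Rightarrow> real).
        prob_space L \<and> is_encoder dC L pA \<and> (\<forall>n\<ge>1. is_decoder dC L n (pB n)) \<and>
        (\<forall>n\<ge>1. \<forall>\<rho>\<in>quantum_states. \<forall>M\<in>povms n. \<forall>b\<in>{1..n}.
           trace (\<rho> ** M b) =
             complex_of_real (\<integral>l. (\<Sum>c\<in>{1..dC}. pA c \<rho> l * pB n b M c l) \<partial>L)))"

text \<open>The infimum of the empty set in \<^typ>\<open>enat\<close> is \<open>\<infinity>\<close>.\<close>

definition classical_cost :: "'l itself \<Rightarrow> 'd::finite itself \<Rightarrow> enat" where
  "classical_cost L D = Inf (enat ` {dC. admits_simulation L D dC})"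

end

theory Submission
  imports Defs
begin

text \<open>
  Restrict a simulation to the pure states spanned by \<open>\<psi> = (1, -v, -s)\<close> and the two-outcome
  measurements that test for \<open>\<phi>\<close> with \<open>\<phi>\<^sup>\<dagger> = (t, w, 1)\<close>, where \<open>s, t \<in> \<complex>\<close> and \<open>v, w \<in> \<complex>\<^sup>2\<close>. The
  probability is \<open>norm z ^ 2\<close> up to normalisation, with \<open>z = t - s - v \<cdot> w\<close>. For one message and one
  value of the shared randomness let \<open>f (s, v)\<close> and \<open>g (t, w)\<close> be the encoder and decoder
  probabilities, cut off to a box, and put \<open>u (s, v) = \<integral> g (s + v \<cdot> w, w) dw\<close>. Integrating the
  simulation identity over the pairs with \<open>z = \<epsilon>\<close> shows that the sum over the messages of
  \<open>\<integral> f (s, v) u (s + \<epsilon>, v)\<close> has expectation at least a constant times \<open>\<epsilon>\<^sup>2\<close>, and that it vanishes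
  for \<open>\<epsilon> = 0\<close>, so that \<open>u = 0\<close> almost everywhere on \<open>{f > 0}\<close>.

  On the other hand \<open>u\<close> has two derivatives in \<open>s\<close> in the \<open>L\<^sup>2\<close> sense: after a Fourier
  transform in \<open>s\<close>, averaging over a Gaussian \<open>v\<close> gains exactly \<open>norm \<sigma> ^ (-4)\<close> in the squared
  norm because \<open>w\<close> ranges over a space of real dimension 4; this is where the dimension enters.
  Hence the second difference of \<open>u\<close> is \<open>O(\<epsilon>\<^sup>2)\<close> in \<open>L\<^sup>2\<close>. It vanishes at each point that lies in
  \<open>A = {f > 0, u = 0}\<close> together with its two translates, and by continuity of translations the
  other points of \<open>A\<close> have measure \<open>o(1)\<close>. So the integral above, symmetrised in \<open>\<epsilon>\<close>, is
  \<open>o(\<epsilon>\<^sup>2)\<close> for each message and each value of the randomness, with a uniform bound; as there are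
  finitely many messages, dominated convergence yields a contradiction.
\<close>

section \<open>Gaussians and translations\<close>

lemma borel_measurable_cis [measurable (raw)]:
  "f \<in> borel_measurable M \<Longrightarrow> (\<lambda>x. cis (f x)) \<in> borel_measurable M"
  unfolding cis_conv_exp by measurable

text \<open>For \<open>a = 1\<close> this is the characteristic function of the standard normal
  distribution, freed of its normalising factor. The substitution x -> a x gives the general
  case.\<close>

lemma gaussian_fourier_real:
  fixes a \<xi> :: real
  assumes a: "a > 0"
  shows "has_bochner_integral lborel (\<lambda>x. exp (- (a * x)\<^sup>2 / 2) *\<^sub>R cis (x * \<xi>))
           (of_real (sqrt (2 * pi) / a * exp (- (\<xi> / a)\<^sup>2 / 2)))"
proof -
  let ?s = "\<lambda>t x. exp (- x\<^sup>2 / 2) *\<^sub>R cis (x * t)"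
  have int1: "integrable lborel (\<lambda>x::real. exp (- x\<^sup>2 / 2))"
    using integrable_normal_moment[of 1 0 0] integrable_mult_right[of "sqrt (2*pi)" lborel "\<lambda>x. std_normal_density x"]
    by (simp add: std_normal_density_def)
  have int: "integrable lborel (?s t)" for t
    by (rule Bochner_Integration.integrable_bound[OF int1]) auto
  have val: "(\<integral>x. ?s t x \<partial>lborel) = of_real (sqrt (2 * pi) * exp (- t\<^sup>2 / 2))" for t
  proof -
    have "complex_of_real (exp (- (t^2) / 2)) = char std_normal_distribution t"
      by (simp add: char_std_normal_distribution)
    also have "\<dots> = (\<integral>x. std_normal_density x *\<^sub>R cis (t * x) \<partial>lborel)"
      unfolding char_def by (subst integral_density) (auto simp: cis_conv_exp)
    also have "\<dots> = (\<integral>x. (1 / sqrt (2 * pi)) *\<^sub>R ?s t x \<partial>lborel)"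
      by (intro Bochner_Integration.integral_cong) (auto simp: std_normal_density_def mult.commute)
    also have "\<dots> = (1 / sqrt (2 * pi)) *\<^sub>R (\<integral>x. ?s t x \<partial>lborel)"
      by (rule integral_scaleR_right)
    finally have "sqrt (2 * pi) *\<^sub>R complex_of_real (exp (- (t^2) / 2)) = sqrt (2 * pi) *\<^sub>R ((1 / sqrt (2 * pi)) *\<^sub>R (\<integral>x. ?s t x \<partial>lborel))"
      by simp
    then show ?thesis by (simp add: scaleR_conv_of_real)
  qed
  define g where "g = ?s (\<xi> / a)"
  have "integrable lborel g" unfolding g_def by (rule int)
  then have "integrable lborel (\<lambda>x. g (0 + a * x))"
    using a by (subst lborel_integrable_real_affine_iff) auto
  moreover have "(\<integral>x. g x \<partial>lborel) = \<bar>a\<bar> *\<^sub>R (\<integral>x. g (0 + a * x) \<partial>lborel)"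
    using a by (intro lborel_integral_real_affine) auto
  then have "complex_of_real (sqrt (2 * pi) / a * exp (- (\<xi> / a)\<^sup>2 / 2)) = (\<integral>x. g (0 + a * x) \<partial>lborel)"
    unfolding val[of "\<xi> / a", folded g_def] using a by (simp add: scaleR_conv_of_real field_simps)
  moreover have "g (0 + a * x) = exp (- (a * x)\<^sup>2 / 2) *\<^sub>R cis (x * \<xi>)" for x
    using a by (simp add: g_def)
  ultimately show ?thesis by (simp add: has_bochner_integral_iff)
qed

text \<open>Lebesgue measure is the image of a product measure under coordinates in
  \<open>Basis\<close>. Both the Gaussian and the character factor over these coordinates, so the
  integral is a product of one-dimensional ones.\<close>

lemma gaussian_fourier:
  fixes \<xi> :: "'a::euclidean_space"
  assumes a: "a > 0"
  shows "has_bochner_integral lborel (\<lambda>x. exp (- (a * norm x)\<^sup>2 / 2) *\<^sub>R cis (x \<bullet> \<xi>))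
           (of_real ((sqrt (2 * pi) / a) ^ DIM('a) * exp (- (norm \<xi> / a)\<^sup>2 / 2)))"
proof -
  let ?f = "\<lambda>b x. exp (- (a * x)\<^sup>2 / 2) *\<^sub>R cis (x * (\<xi> \<bullet> b))"
  let ?F = "\<lambda>x::'a. exp (- (a * norm x)\<^sup>2 / 2) *\<^sub>R cis (x \<bullet> \<xi>)"
  interpret product_sigma_finite "\<lambda>_::'a. lborel :: real measure" by standard
  have g: "has_bochner_integral lborel (?f b) (of_real (sqrt (2 * pi) / a * exp (- ((\<xi> \<bullet> b) / a)\<^sup>2 / 2)))" for b
    using gaussian_fourier_real[OF a] .
  have cis_sum: "cis (sum h A) = (\<Prod>b\<in>A. cis (h b))" if "finite A" for h :: "'a \<Rightarrow> real" and A
    using that by (induction A rule: finite_induct) (auto simp: cis_mult[symmetric])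
  have F: "?F (\<Sum>b\<in>Basis. f b *\<^sub>R b) = (\<Prod>b\<in>Basis. ?f b (f b))" for f :: "'a \<Rightarrow> real"
  proof -
    let ?x = "\<Sum>b\<in>Basis. f b *\<^sub>R b"
    have "(norm ?x)\<^sup>2 = (\<Sum>b\<in>Basis. (f b)\<^sup>2)"
      by (subst power2_norm_eq_inner, subst euclidean_inner) (auto simp: inner_sum_left_Basis power2_eq_square intro!: sum.cong)
    then have 1: "- (a * norm ?x)\<^sup>2 / 2 = (\<Sum>b\<in>Basis. - (a * f b)\<^sup>2 / 2)"
      by (simp add: power_mult_distrib sum_distrib_left sum_divide_distrib sum_negf)
    have 2: "?x \<bullet> \<xi> = (\<Sum>b\<in>Basis. f b * (\<xi> \<bullet> b))"
      by (subst euclidean_inner) (auto simp: inner_sum_left_Basis intro!: sum.cong)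
    show ?thesis
      unfolding 1 2 cis_sum[OF finite_Basis] exp_sum[OF finite_Basis]
      by (simp add: scaleR_conv_of_real prod.distrib)
  qed
  have meas: "(\<lambda>f. \<Sum>b\<in>Basis. f b *\<^sub>R b) \<in> measurable (\<Pi>\<^sub>M b\<in>Basis. lborel) (borel :: 'a measure)"
    by measurable
  have i1: "integrable (\<Pi>\<^sub>M b\<in>Basis. lborel) (\<lambda>f. ?F (\<Sum>b\<in>Basis. f b *\<^sub>R b))"
    unfolding F by (rule product_integrable_prod) (use g in \<open>auto simp: has_bochner_integral_iff\<close>)
  then have i: "integrable lborel ?F"
    by (subst lborel_eq) (simp add: integrable_distr_eq meas)
  have "(\<integral>x. ?F x \<partial>lborel) = (\<integral>f. ?F (\<Sum>b\<in>Basis. f b *\<^sub>R b) \<partial>(\<Pi>\<^sub>M b\<in>Basis. lborel))"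
    by (subst lborel_eq) (simp add: integral_distr meas)
  also have "\<dots> = (\<Prod>b\<in>Basis. \<integral>x. ?f b x \<partial>lborel)"
    unfolding F by (rule product_integral_prod) (use g in \<open>auto simp: has_bochner_integral_iff\<close>)
  also have "\<dots> = (\<Prod>b\<in>Basis. of_real (sqrt (2 * pi) / a * exp (- ((\<xi> \<bullet> b) / a)\<^sup>2 / 2)))"
    using g by (intro prod.cong refl) (simp add: has_bochner_integral_iff)
  also have "\<dots> = of_real (\<Prod>b\<in>Basis. sqrt (2 * pi) / a * exp (- ((\<xi> \<bullet> b) / a)\<^sup>2 / 2))"
    by simp
  also have "(\<Prod>b\<in>Basis. sqrt (2 * pi) / a * exp (- ((\<xi> \<bullet> b) / a)\<^sup>2 / 2))
     = (sqrt (2 * pi) / a) ^ DIM('a) * exp (\<Sum>b\<in>Basis. - ((\<xi> \<bullet> b) / a)\<^sup>2 / 2)"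
    unfolding exp_sum[OF finite_Basis] prod.distrib by simp
  also have "(\<Sum>b\<in>Basis. - ((\<xi> \<bullet> b) / a)\<^sup>2 / 2) = - (norm \<xi> / a)\<^sup>2 / 2"
  proof -
    have "(norm \<xi>)\<^sup>2 = (\<Sum>b\<in>Basis. (\<xi> \<bullet> b)\<^sup>2)"
      by (subst power2_norm_eq_inner, subst euclidean_inner) (simp add: power2_eq_square)
    then show ?thesis by (simp add: power_divide sum_negf sum_divide_distrib)
  qed
  finally show ?thesis using i by (simp add: has_bochner_integral_iff)
qed

section \<open>Translation invariance of Lebesgue measure and continuity of translations in
  L1\<close>

lemma nn_integral_lborel_translation:
  fixes f :: "'a::euclidean_space \<Rightarrow> ennreal"
  assumes [measurable]: "f \<in> borel_measurable borel"
  shows "(\<integral>\<^sup>+x. f (x + c) \<partial>lborel) = (\<integral>\<^sup>+x. f x \<partial>lborel)"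
  by (subst (2) lborel_distr_plus[of c, symmetric], subst nn_integral_distr) (auto simp: add.commute)

lemma integrable_lborel_translation:
  fixes f :: "'a::euclidean_space \<Rightarrow> 'b::{banach, second_countable_topology}"
  assumes "integrable lborel f"
  shows "integrable lborel (\<lambda>x. f (x + c))"
proof -
  have [measurable]: "f \<in> borel_measurable borel"
    using borel_measurable_integrable[OF assms] by simp
  have "integrable (distr lborel borel (\<lambda>x. c + x)) f" using assms by (simp add: lborel_distr_plus)
  then have "integrable lborel (\<lambda>x. f (c + x))" by (subst (asm) integrable_distr_eq) auto
  then show ?thesis by (simp only: add.commute)
qed

lemma integral_lborel_translation:
  fixes f :: "'a::euclidean_space \<Rightarrow> 'b::{banach, second_countable_topology}"
  assumes "f \<in> borel_measurable borel"
  shows "(\<integral>x. f (x + c) \<partial>lborel) = (\<integral>x. f x \<partial>lborel)"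
  by (subst (2) lborel_distr_plus[of c, symmetric], subst integral_distr) (auto simp: add.commute assms)

text \<open>A density argument: open sets of finite measure by dominated convergence, Borel sets of
  finite measure by outer regularity, then integrable functions by linearity and approximation with
  simple functions.\<close>

lemma translation_continuous_L1:
  fixes f :: "'a::euclidean_space \<Rightarrow> real"
  assumes f: "integrable lborel f" and X: "X \<longlonglongrightarrow> 0"
  shows "(\<lambda>n. \<integral>\<^sup>+x. ennreal \<bar>f (x + X n) - f x\<bar> \<partial>lborel) \<longlonglongrightarrow> 0"
proof -
  define D where "D f n = (\<integral>\<^sup>+x. ennreal \<bar>f (x + X n) - f x\<bar> \<partial>lborel)" for f :: "'a \<Rightarrow> real" and n
  define N where "N f = (\<integral>\<^sup>+x. ennreal \<bar>f x\<bar> \<partial>lborel)" for f :: "'a \<Rightarrow> real"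
  have D_add: "D (\<lambda>x. f x + g x) n \<le> D f n + D g n"
    if [measurable]: "f \<in> borel_measurable borel" "g \<in> borel_measurable borel" for f g n
  proof -
    have "D (\<lambda>x. f x + g x) n \<le> (\<integral>\<^sup>+x. ennreal \<bar>f (x + X n) - f x\<bar> + ennreal \<bar>g (x + X n) - g x\<bar> \<partial>lborel)"
      unfolding D_def by (intro nn_integral_mono) (auto simp flip: ennreal_plus)
    then show ?thesis unfolding D_def by (subst (asm) nn_integral_add) auto
  qed
  have D_N: "D f n \<le> N f + N f" if [measurable]: "f \<in> borel_measurable borel" for f n
  proof -
    have "D f n \<le> (\<integral>\<^sup>+x. ennreal \<bar>f (x + X n)\<bar> + ennreal \<bar>f x\<bar> \<partial>lborel)"
      unfolding D_def by (intro nn_integral_mono) (auto simp flip: ennreal_plus)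
    then show ?thesis unfolding N_def
      by (subst (asm) nn_integral_add)
         (auto simp: nn_integral_lborel_translation[of "\<lambda>x. ennreal \<bar>f x\<bar>"])
  qed
  \<comment> \<open>The functions with the property are closed in L1, since \<open>D f n\<close> is
    at most \<open>D g n\<close> plus twice the L1 distance of \<open>f\<close> and
    \<open>g\<close>. This serves both the passage from open to Borel sets and the passage to limits
    of simple functions.\<close>
  have approx: "D f \<longlonglongrightarrow> 0"
    if f: "f \<in> borel_measurable borel"
      and ap: "\<And>e. e > 0 \<Longrightarrow> \<exists>g\<in>borel_measurable borel. D g \<longlonglongrightarrow> 0 \<and> N (\<lambda>x. f x - g x) \<le> ennreal e" for f
  proof (rule order_tendstoI)
    fix a :: ennreal assume "a < 0" then show "eventually (\<lambda>n. a < D f n) sequentially" by simp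
  next
    fix a :: ennreal assume "0 < a"
    then obtain e where e: "e > 0" "ennreal (3 * e) < a"
    proof (cases a)
      case (real r) then show ?thesis using that[of "r/4"] \<open>0 < a\<close> by (auto simp: ennreal_less_iff)
    next
      case top then show ?thesis using that[of 1] by simp
    qed
    obtain g where g: "g \<in> borel_measurable borel" "D g \<longlonglongrightarrow> 0" "N (\<lambda>x. f x - g x) \<le> ennreal e"
      using ap[OF e(1)] by blast
    have "eventually (\<lambda>n. D g n < ennreal e) sequentially"
      using order_tendstoD(2)[OF g(2), of "ennreal e"] e(1) by simp
    then show "eventually (\<lambda>n. D f n < a) sequentially"
    proof eventually_elim
      case (elim n)
      have "D f n = D (\<lambda>x. g x + (f x - g x)) n" by simp
      also have "\<dots> \<le> D g n + D (\<lambda>x. f x - g x) n" using f g(1) by (intro D_add) auto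
      also have "D (\<lambda>x. f x - g x) n \<le> ennreal e + ennreal e"
        using f g(1) by (intro order_trans[OF D_N add_mono[OF g(3) g(3)]]) auto
      also have "D g n + (ennreal e + ennreal e) \<le> ennreal e + (ennreal e + ennreal e)"
        using elim by (intro add_right_mono) simp
      also have "\<dots> = ennreal (3 * e)" using e(1) by (simp flip: ennreal_plus)
      finally show ?case using e(2) by simp
    qed
  qed
  have open_case: "D (indicator U) \<longlonglongrightarrow> 0" if U: "open U" and fin: "emeasure lborel U < \<infinity>" for U :: "'a set"
  proof -
    have [measurable]: "U \<in> sets borel" using U by auto
    let ?p = "\<lambda>n x. ennreal (indicator U x - indicator U (x + X n))"
    let ?q = "\<lambda>n x. ennreal (indicator U (x + X n) - indicator U x)"
    \<comment> \<open>\<open>ennreal\<close> sends negative numbers to 0, so \<open>?p\<close> and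
      \<open>?q\<close> are the two signed parts of the difference. Only \<open>?p\<close> lives on
      the fixed set \<open>U\<close> and hence has a majorant. The parts have equal integrals
      because \<open>U\<close> and its translate have the same finite measure.\<close>
    have pq: "(\<integral>\<^sup>+x. ?q n x \<partial>lborel) = (\<integral>\<^sup>+x. ?p n x \<partial>lborel)" for n
    proof -
      have 1: "(\<integral>\<^sup>+x. indicator U (x + X n) \<partial>lborel) = emeasure lborel U"
        using nn_integral_lborel_translation[of "indicator U" "X n"] by simp
      have 2: "(\<integral>\<^sup>+x. ?q n x \<partial>lborel) + (\<integral>\<^sup>+x. indicator U x \<partial>lborel) = (\<integral>\<^sup>+x. ?p n x \<partial>lborel) + (\<integral>\<^sup>+x. indicator U (x + X n) \<partial>lborel)"
        by (subst (1 2) nn_integral_add[symmetric])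
           (auto intro!: nn_integral_cong simp: indicator_def ennreal_neg)
      then have "emeasure lborel U + (\<integral>\<^sup>+x. ?q n x \<partial>lborel) = emeasure lborel U + (\<integral>\<^sup>+x. ?p n x \<partial>lborel)"
        using 1 by (simp add: add.commute)
      then show ?thesis using fin unfolding ennreal_add_left_cancel by auto
    qed
    have "(\<lambda>n. \<integral>\<^sup>+x. ?p n x \<partial>lborel) \<longlonglongrightarrow> (\<integral>\<^sup>+x. 0 \<partial>(lborel::'a measure))"
    proof (rule nn_integral_dominated_convergence[where w="indicator U"])
      show "(\<integral>\<^sup>+x. indicator U x \<partial>lborel) < \<infinity>" using fin by simp
      show "AE x in lborel. (\<lambda>n. ?p n x) \<longlonglongrightarrow> 0"
      proof (rule AE_I2)
        fix x
        show "(\<lambda>n. ?p n x) \<longlonglongrightarrow> 0"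
        proof (cases "x \<in> U")
          case True
          have "(\<lambda>n. x + X n) \<longlonglongrightarrow> x + 0" by (intro tendsto_intros X)
          then have "eventually (\<lambda>n. x + X n \<in> U) sequentially"
            using topological_tendstoD[OF _ U] True by simp
          then have "eventually (\<lambda>n. ?p n x = 0) sequentially"
            by eventually_elim (use True in auto)
          then show ?thesis by (simp add: tendsto_eventually)
        next
          case False then show ?thesis by (simp add: indicator_def ennreal_neg)
        qed
      qed
    qed (auto simp: indicator_def ennreal_neg)
    then have "(\<lambda>n. (\<integral>\<^sup>+x. ?p n x \<partial>lborel) + (\<integral>\<^sup>+x. ?q n x \<partial>lborel)) \<longlonglongrightarrow> 0 + 0"
      unfolding pq by (intro tendsto_add) simp_all
    moreover have "D (indicator U) = (\<lambda>n. (\<integral>\<^sup>+x. ?p n x \<partial>lborel) + (\<integral>\<^sup>+x. ?q n x \<partial>lborel))"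
      unfolding D_def fun_eq_iff by (intro allI, subst nn_integral_add[symmetric]) (auto intro!: nn_integral_cong simp: indicator_def ennreal_neg)
    ultimately show ?thesis by simp
  qed
  have ind_case: "D (indicator A) \<longlonglongrightarrow> 0" if A[measurable]: "A \<in> sets borel" and fin: "emeasure lborel A < \<infinity>" for A :: "'a set"
  proof (rule approx)
    fix e :: real assume "e > 0"
    obtain U where U: "open U" "A \<subseteq> U" "emeasure lborel (U - A) < ennreal e"
      by (rule outer_regular_lborel[OF A \<open>e > 0\<close>])
    have [measurable]: "U \<in> sets borel" using U by auto
    have "emeasure lborel U = emeasure lborel A + emeasure lborel (U - A)"
      using U(2) by (subst plus_emeasure) (auto simp: Un_absorb1)
    also have "\<dots> < \<infinity>" using fin U(3) by (auto simp: less_top[symmetric] top_unique)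
    finally have "D (indicator U) \<longlonglongrightarrow> 0" using open_case U(1) by blast
    moreover have "N (\<lambda>x. indicator A x - indicator U x) = (\<integral>\<^sup>+x. indicator (U - A) x \<partial>lborel)"
      unfolding N_def using U(2) by (intro nn_integral_cong) (auto simp: indicator_def)
    ultimately show "\<exists>g\<in>borel_measurable borel. D g \<longlonglongrightarrow> 0 \<and> N (\<lambda>x. indicator A x - g x) \<le> ennreal e"
      using U(3) by (intro bexI[of _ "indicator U"]) auto
  qed simp
  have "D f \<longlonglongrightarrow> 0" using f
  proof (induction f rule: integrable_induct)
    case (base A c)
    have "D (\<lambda>x. indicator A x *\<^sub>R c) = (\<lambda>n. ennreal \<bar>c\<bar> * D (indicator A) n)"
    proof
      fix n show "D (\<lambda>x. indicator A x *\<^sub>R c) n = ennreal \<bar>c\<bar> * D (indicator A) n"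
      proof -
        have [measurable]: "A \<in> sets borel" using base by simp
        have "ennreal \<bar>indicator A (x + X n) *\<^sub>R c - indicator A x *\<^sub>R c\<bar>
            = ennreal \<bar>c\<bar> * ennreal \<bar>indicator A (x + X n) - indicator A x\<bar>" for x
          by (auto simp: indicator_def)
        then show ?thesis
          unfolding D_def by (simp only:) (rule nn_integral_cmult, measurable)
      qed
    qed
    moreover have "(\<lambda>n. ennreal \<bar>c\<bar> * D (indicator A) n) \<longlonglongrightarrow> ennreal \<bar>c\<bar> * 0"
      using base by (intro tendsto_intros ind_case ennreal_tendsto_cmult) auto
    ultimately show ?case by simp
  next
    case (add f g)
    have [measurable]: "f \<in> borel_measurable borel" "g \<in> borel_measurable borel"
      using add borel_measurable_integrable by force+
    have le: "\<forall>n. D (\<lambda>x. f x + g x) n \<le> D f n + D g n"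
      by (intro allI D_add) measurable
    have "(\<lambda>n. D f n + D g n) \<longlonglongrightarrow> 0"
      using tendsto_add[OF add.IH] by simp
    from tendsto_sandwich[OF _ always_eventually[OF le] tendsto_const this]
    show ?case by simp
  next
    case (lim f s)
    have [measurable]: "f \<in> borel_measurable borel" "\<And>i. s i \<in> borel_measurable borel"
      using lim.hyps(1,4) borel_measurable_integrable by force+
    show ?case
    proof (rule approx)
      fix e :: real assume e: "e > 0"
      have "(\<lambda>i. N (\<lambda>x. f x - s i x)) \<longlonglongrightarrow> (\<integral>\<^sup>+x. 0 \<partial>(lborel::'a measure))"
        unfolding N_def
      proof (rule nn_integral_dominated_convergence[where w="\<lambda>x. ennreal (3 * \<bar>f x\<bar>)"])
        show "(\<integral>\<^sup>+x. ennreal (3 * \<bar>f x\<bar>) \<partial>lborel) < \<infinity>"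
          using lim.hyps(4)
          by (simp add: integrable_iff_bounded ennreal_mult nn_integral_cmult ennreal_mult_less_top)
        \<comment> \<open>The approximants satisfy \<open>norm (s i x) \<le> 2 * norm (f x)\<close>,
          whence the 3.\<close>
        show "AE x in lborel. ennreal \<bar>f x - s i x\<bar> \<le> ennreal (3 * \<bar>f x\<bar>)" for i
        proof (rule AE_I2)
          fix x show "ennreal \<bar>f x - s i x\<bar> \<le> ennreal (3 * \<bar>f x\<bar>)"
            using lim.hyps(3)[of x i] by (intro ennreal_leI) auto
        qed
        show "AE x in lborel. (\<lambda>i. ennreal \<bar>f x - s i x\<bar>) \<longlonglongrightarrow> 0"
        proof (rule AE_I2)
          fix x have "(\<lambda>i. \<bar>f x - s i x\<bar>) \<longlonglongrightarrow> \<bar>f x - f x\<bar>" by (intro tendsto_intros lim.hyps(2)) simp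
          then show "(\<lambda>i. ennreal \<bar>f x - s i x\<bar>) \<longlonglongrightarrow> 0"
            by (subst ennreal_0[symmetric], intro tendsto_ennrealI) simp
        qed
      qed auto
      then have "eventually (\<lambda>i. N (\<lambda>x. f x - s i x) < ennreal e) sequentially"
        using order_tendstoD(2)[of _ 0 _ "ennreal e"] e by simp
      then obtain i where "N (\<lambda>x. f x - s i x) < ennreal e" by (auto simp: eventually_sequentially)
      then show "\<exists>g\<in>borel_measurable borel. D g \<longlonglongrightarrow> 0 \<and> N (\<lambda>x. f x - g x) \<le> ennreal e"
        using lim.IH by (intro bexI[of _ "s i"]) auto
    qed simp
  qed
  then show ?thesis unfolding D_def .
qed

section \<open>Plancherel\<close>

lemma integral_lborel_scaleR:
  fixes f :: "'a::euclidean_space \<Rightarrow> 'b::{banach, second_countable_topology}"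
  assumes [measurable]: "f \<in> borel_measurable borel" and c: "c > 0"
  shows "(\<integral>x. f x \<partial>lborel) = (c ^ DIM('a)) *\<^sub>R (\<integral>x. f (c *\<^sub>R x) \<partial>lborel)"
proof -
  have "(\<integral>x. f x \<partial>lborel) = (\<integral>x. f x \<partial>density (distr lborel borel (\<lambda>x::'a. 0 + c *\<^sub>R x)) (\<lambda>_. ennreal (\<bar>c\<bar>^DIM('a))))"
    using lborel_affine[of c "0::'a"] c by simp
  also have "\<dots> = (\<integral>x. (c ^ DIM('a)) *\<^sub>R f (c *\<^sub>R x) \<partial>lborel)"
    using c by (subst integral_density, simp, simp, simp, subst integral_distr) auto
  also have "\<dots> = (c ^ DIM('a)) *\<^sub>R (\<integral>x. f (c *\<^sub>R x) \<partial>lborel)"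
    by (rule integral_scaleR_right)
  finally show ?thesis .
qed

text \<open>A majorant of product form is integrable by Fubini; this justifies exchanges of
  integrals in the Plancherel and oscillatory estimates.\<close>

lemma integrable_lborel_pair_bound:
  fixes f :: "'a::euclidean_space \<times> 'b::euclidean_space \<Rightarrow> 'c::{banach, second_countable_topology}"
  assumes f[measurable]: "f \<in> borel_measurable (lborel \<Otimes>\<^sub>M lborel)"
    and g: "integrable lborel g" and k: "integrable lborel k"
    and le: "\<And>x y. norm (f (x, y)) \<le> g x * k y"
  shows "integrable (lborel \<Otimes>\<^sub>M lborel) f"
proof -
  have [measurable]: "g \<in> borel_measurable borel" "k \<in> borel_measurable borel"
    using borel_measurable_integrable[OF g] borel_measurable_integrable[OF k] by simp_all
  have i: "integrable (lborel \<Otimes>\<^sub>M lborel) (\<lambda>(x, y). g x * k y)"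
  proof (rule lborel_pair.Fubini_integrable)
    show "integrable lborel (\<lambda>x. \<integral>y. norm (case (x, y) of (x, y) \<Rightarrow> g x * k y) \<partial>lborel)"
      using g by (simp add: abs_mult)
    show "AE x in lborel. integrable lborel (\<lambda>y. case (x, y) of (x, y) \<Rightarrow> g x * k y)"
      using k by simp
  qed measurable
  show ?thesis
  proof (rule Bochner_Integration.integrable_bound[OF i f], rule AE_I2)
    fix p show "norm (f p) \<le> norm (case p of (x, y) \<Rightarrow> g x * k y)"
      using le[of "fst p" "snd p"] by (simp add: case_prod_beta)
  qed
qed

text \<open>No normalising prefactor: this is the origin of the factor
  \<open>(2 * pi) ^ DIM('a)\<close> in \<open>plancherel\<close>.\<close>

definition fourier :: "('a::euclidean_space \<Rightarrow> real) \<Rightarrow> 'a \<Rightarrow> complex" where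
  "fourier h \<sigma> = (\<integral>s. h s *\<^sub>R cis (- (s \<bullet> \<sigma>)) \<partial>lborel)"

lemma integrable_scaleR_cis:
  fixes h :: "'a \<Rightarrow> real"
  assumes "integrable M h" "\<theta> \<in> borel_measurable M"
  shows "integrable M (\<lambda>s. h s *\<^sub>R cis (\<theta> s))"
  using assms by (intro Bochner_Integration.integrable_bound[OF assms(1)])
    (auto dest: borel_measurable_integrable)

lemma borel_measurable_fourier [measurable]:
  fixes h :: "'a::euclidean_space \<Rightarrow> real"
  assumes [measurable]: "h \<in> borel_measurable borel"
  shows "fourier h \<in> borel_measurable borel"
  unfolding fourier_def by measurable

lemma gaussian_integrable:
  assumes "a > 0"
  shows "integrable lborel (\<lambda>x::'a::euclidean_space. exp (- (a * norm x)\<^sup>2 / 2))"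
    and "(\<integral>x. exp (- (a * norm x)\<^sup>2 / 2) \<partial>(lborel::'a measure)) = (sqrt (2 * pi) / a) ^ DIM('a)"
proof -
  have *: "has_bochner_integral lborel (\<lambda>x::'a. complex_of_real (exp (- (a * norm x)\<^sup>2 / 2))) (of_real ((sqrt (2 * pi) / a) ^ DIM('a)))"
    using gaussian_fourier[OF assms, of "0::'a"] by (simp add: scaleR_conv_of_real)
  show "integrable lborel (\<lambda>x::'a. exp (- (a * norm x)\<^sup>2 / 2))"
    using * by (simp only: has_bochner_integral_iff complex_of_real_integrable_eq)
  show "(\<integral>x. exp (- (a * norm x)\<^sup>2 / 2) \<partial>(lborel::'a measure)) = (sqrt (2 * pi) / a) ^ DIM('a)"
    using * by (simp only: has_bochner_integral_iff integral_complex_of_real of_real_eq_iff)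
qed

text \<open>The squared modulus of the transform is the transform of the autocorrelation
  \<open>K\<close>, and \<open>K 0\<close> is the squared L2 norm. Damping the frequency integral
  with a wide Gaussian allows Fubini, and widening the Gaussian gives the claim: by monotone
  convergence on the left, by continuity of \<open>K\<close> at 0 on the right. Nonnegative
  integrals spare a separate proof that the transform is square integrable.\<close>

theorem plancherel:
  fixes h :: "'a::euclidean_space \<Rightarrow> real"
  assumes h: "integrable lborel h" and bnd: "\<And>x. \<bar>h x\<bar> \<le> C"
  shows "(\<integral>\<^sup>+\<sigma>. ennreal ((norm (fourier h \<sigma>))\<^sup>2) \<partial>lborel) = ennreal ((2 * pi) ^ DIM('a)) * (\<integral>\<^sup>+x. ennreal ((h x)\<^sup>2) \<partial>lborel)"
proof -
  define K where "K \<zeta> = (\<integral>s. h s * h (\<zeta> + s) \<partial>lborel)" for \<zeta>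
  have [measurable]: "h \<in> borel_measurable borel"
    using borel_measurable_integrable[OF h] by simp
  have K_meas[measurable]: "K \<in> borel_measurable borel"
    unfolding K_def by measurable
  have C: "C \<ge> 0" using bnd[of 0] by linarith
  have hb: "\<bar>h s\<bar> * \<bar>h t\<bar> \<le> C * \<bar>h s\<bar>" for s t
    using mult_right_mono[OF bnd[of t], of "\<bar>h s\<bar>"] by (simp add: mult.commute)
  have h_tr: "integrable lborel (\<lambda>s. h (\<zeta> + s))" for \<zeta>
    using integrable_lborel_translation[OF h, of \<zeta>] by (simp only: add.commute)
  have h_prod: "integrable lborel (\<lambda>s. h s * h (\<zeta> + s))" for \<zeta>
  proof (rule Bochner_Integration.integrable_bound[of _ "\<lambda>s. C * \<bar>h s\<bar>"])
    show "AE s in lborel. norm (h s * h (\<zeta> + s)) \<le> norm (C * \<bar>h s\<bar>)"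
      using hb C by (simp add: abs_mult)
  qed (use h in auto)
  \<comment> \<open>By translation invariance the product has finite integral, the square of the L1
    norm in absolute value. This makes \<open>K\<close> integrable and justifies Fubini in
    \<open>autocorrelation\<close>.\<close>
  have pair: "integrable (lborel \<Otimes>\<^sub>M lborel) (\<lambda>(s, \<zeta>). h s * h (\<zeta> + s))"
  proof (rule lborel_pair.Fubini_integrable)
    have "(\<integral>\<zeta>. \<bar>h (\<zeta> + s)\<bar> \<partial>lborel) = (\<integral>\<zeta>. \<bar>h \<zeta>\<bar> \<partial>lborel)" for s
      by (rule integral_lborel_translation[of "\<lambda>x. \<bar>h x\<bar>"]) measurable
    then show "integrable lborel (\<lambda>s. \<integral>\<zeta>. norm (case (s, \<zeta>) of (s, \<zeta>) \<Rightarrow> h s * h (\<zeta> + s)) \<partial>lborel)"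
      using h by (simp add: abs_mult)
    show "AE s in lborel. integrable lborel (\<lambda>\<zeta>. case (s, \<zeta>) of (s, \<zeta>) \<Rightarrow> h s * h (\<zeta> + s))"
      using integrable_lborel_translation[OF h] by simp
  qed measurable
  have K_int: "integrable lborel K"
    using lborel_pair.integrable_snd[OF pair] by (simp add: K_def[abs_def])
  have autocorrelation: "complex_of_real ((norm (fourier h \<sigma>))\<^sup>2) = (\<integral>\<zeta>. K \<zeta> *\<^sub>R cis (\<zeta> \<bullet> \<sigma>) \<partial>lborel)" for \<sigma>
  proof -
    have cnj: "cnj (fourier h \<sigma>) = (\<integral>s. h s *\<^sub>R cis (s \<bullet> \<sigma>) \<partial>lborel)"
      unfolding fourier_def by (subst Bochner_Integration.integral_cnj[symmetric]) (simp add: cis_cnj)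
    \<comment> \<open>Translating the integration variable by \<open>s\<close> merges the two phases
      into one that depends on \<zeta> alone.\<close>
    have shift: "cis (- (s \<bullet> \<sigma>)) * cnj (fourier h \<sigma>) = (\<integral>\<zeta>. h (\<zeta> + s) *\<^sub>R cis (\<zeta> \<bullet> \<sigma>) \<partial>lborel)" for s
    proof -
      have "cnj (fourier h \<sigma>) = (\<integral>\<zeta>. h (\<zeta> + s) *\<^sub>R cis ((\<zeta> + s) \<bullet> \<sigma>) \<partial>lborel)"
        unfolding cnj by (rule integral_lborel_translation[symmetric]) measurable
      also have "\<dots> = (\<integral>\<zeta>. cis (s \<bullet> \<sigma>) * (h (\<zeta> + s) *\<^sub>R cis (\<zeta> \<bullet> \<sigma>)) \<partial>lborel)"
        by (intro Bochner_Integration.integral_cong) (auto simp: inner_add_left cis_mult[symmetric])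
      also have "\<dots> = cis (s \<bullet> \<sigma>) * (\<integral>\<zeta>. h (\<zeta> + s) *\<^sub>R cis (\<zeta> \<bullet> \<sigma>) \<partial>lborel)"
        by (rule integral_mult_right_zero)
      finally show ?thesis by (simp add: cis_mult mult.assoc[symmetric])
    qed
    have "complex_of_real ((norm (fourier h \<sigma>))\<^sup>2) = fourier h \<sigma> * cnj (fourier h \<sigma>)"
      by (rule complex_norm_square)
    also have "\<dots> = (\<integral>s. (h s *\<^sub>R cis (- (s \<bullet> \<sigma>))) * cnj (fourier h \<sigma>) \<partial>lborel)"
      unfolding fourier_def by (rule integral_mult_left_zero[symmetric])
    also have "\<dots> = (\<integral>s. h s *\<^sub>R (\<integral>\<zeta>. h (\<zeta> + s) *\<^sub>R cis (\<zeta> \<bullet> \<sigma>) \<partial>lborel) \<partial>lborel)"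
      by (simp add: shift)
    also have "\<dots> = (\<integral>s. (\<integral>\<zeta>. (h s * h (\<zeta> + s)) *\<^sub>R cis (\<zeta> \<bullet> \<sigma>) \<partial>lborel) \<partial>lborel)"
      by (simp flip: integral_scaleR_right)
    also have "\<dots> = (\<integral>\<zeta>. (\<integral>s. (h s * h (\<zeta> + s)) *\<^sub>R cis (\<zeta> \<bullet> \<sigma>) \<partial>lborel) \<partial>lborel)"
    proof (rule lborel_pair.Fubini_integral[symmetric])
      show "integrable (lborel \<Otimes>\<^sub>M lborel) (\<lambda>(s, \<zeta>). (h s * h (\<zeta> + s)) *\<^sub>R cis (\<zeta> \<bullet> \<sigma>))"
        by (rule Bochner_Integration.integrable_bound[OF pair]) auto
    qed
    also have "\<dots> = (\<integral>\<zeta>. K \<zeta> *\<^sub>R cis (\<zeta> \<bullet> \<sigma>) \<partial>lborel)"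
      unfolding K_def using h_prod by simp
    finally show ?thesis .
  qed
  \<comment> \<open>Fubini moves the transform onto the Gaussian. The substitution \<zeta> = a
    \<eta> then leaves \<open>a\<close> only in the argument of \<open>K\<close>, so one fixed
    Gaussian dominates as \<open>a\<close> tends to 0.\<close>
  have smoothed: "(\<integral>\<sigma>. exp (- (a * norm \<sigma>)\<^sup>2 / 2) * (norm (fourier h \<sigma>))\<^sup>2 \<partial>lborel)
      = sqrt (2 * pi) ^ DIM('a) * (\<integral>\<eta>. K (a *\<^sub>R \<eta>) * exp (- (1 * norm \<eta>)\<^sup>2 / 2) \<partial>lborel)" (is "?L = ?R")
    if a: "a > 0" for a
  proof -
    have "complex_of_real ?L = (\<integral>\<sigma>. complex_of_real (exp (- (a * norm \<sigma>)\<^sup>2 / 2) * (norm (fourier h \<sigma>))\<^sup>2) \<partial>lborel)"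
      by (rule integral_complex_of_real[symmetric])
    also have "\<dots> = (\<integral>\<sigma>. exp (- (a * norm \<sigma>)\<^sup>2 / 2) *\<^sub>R (\<integral>\<zeta>. K \<zeta> *\<^sub>R cis (\<zeta> \<bullet> \<sigma>) \<partial>lborel) \<partial>lborel)"
      by (simp only: of_real_mult autocorrelation scaleR_conv_of_real)
    also have "\<dots> = (\<integral>\<sigma>. (\<integral>\<zeta>. K \<zeta> *\<^sub>R (exp (- (a * norm \<sigma>)\<^sup>2 / 2) *\<^sub>R cis (\<sigma> \<bullet> \<zeta>)) \<partial>lborel) \<partial>lborel)"
      by (simp flip: integral_scaleR_right add: inner_commute mult.commute)
    also have "\<dots> = (\<integral>\<zeta>. (\<integral>\<sigma>. K \<zeta> *\<^sub>R (exp (- (a * norm \<sigma>)\<^sup>2 / 2) *\<^sub>R cis (\<sigma> \<bullet> \<zeta>)) \<partial>lborel) \<partial>lborel)"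
    proof (rule lborel_pair.Fubini_integral[symmetric], rule integrable_lborel_pair_bound[OF _ gaussian_integrable(1)[OF a] integrable_abs[OF K_int]])
    qed (auto simp: mult.commute abs_mult)
    also have "\<dots> = (\<integral>\<zeta>. complex_of_real (K \<zeta> * ((sqrt (2 * pi) / a) ^ DIM('a) * exp (- (norm \<zeta> / a)\<^sup>2 / 2))) \<partial>lborel)"
    proof (intro Bochner_Integration.integral_cong refl)
      fix \<zeta> :: 'a
      show "(\<integral>\<sigma>. K \<zeta> *\<^sub>R (exp (- (a * norm \<sigma>)\<^sup>2 / 2) *\<^sub>R cis (\<sigma> \<bullet> \<zeta>)) \<partial>lborel)
          = complex_of_real (K \<zeta> * ((sqrt (2 * pi) / a) ^ DIM('a) * exp (- (norm \<zeta> / a)\<^sup>2 / 2)))"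
        unfolding integral_scaleR_right has_bochner_integral_integral_eq[OF gaussian_fourier[OF a]]
        by (simp add: scaleR_conv_of_real)
    qed
    also have "\<dots> = complex_of_real (\<integral>\<zeta>. K \<zeta> * ((sqrt (2 * pi) / a) ^ DIM('a) * exp (- (norm \<zeta> / a)\<^sup>2 / 2)) \<partial>lborel)"
      by (rule integral_complex_of_real)
    finally have "?L = (\<integral>\<zeta>. K \<zeta> * ((sqrt (2 * pi) / a) ^ DIM('a) * exp (- (norm \<zeta> / a)\<^sup>2 / 2)) \<partial>lborel)"
      by (simp only: of_real_eq_iff)
    also have "\<dots> = a ^ DIM('a) *\<^sub>R (\<integral>\<eta>. K (a *\<^sub>R \<eta>) * ((sqrt (2 * pi) / a) ^ DIM('a) * exp (- (norm (a *\<^sub>R \<eta>) / a)\<^sup>2 / 2)) \<partial>lborel)"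
      by (rule integral_lborel_scaleR[OF _ a]) measurable
    also have "\<dots> = a ^ DIM('a) * ((sqrt (2 * pi) / a) ^ DIM('a) * (\<integral>\<eta>. K (a *\<^sub>R \<eta>) * exp (- (1 * norm \<eta>)\<^sup>2 / 2) \<partial>lborel))"
      using a by (subst integral_mult_right_zero[symmetric]) (simp add: mult.left_commute)
    also have "\<dots> = ?R" using a by (simp add: power_divide)
    finally show ?thesis .
  qed
  define a :: "nat \<Rightarrow> real" where "a n = 1 / real (Suc n)" for n
  have a_pos: "a n > 0" for n by (simp add: a_def)
  have a_lim: "a \<longlonglongrightarrow> 0" unfolding a_def by (rule lim_1_over_n[THEN LIMSEQ_Suc])
  have K_bound: "\<bar>K \<zeta>\<bar> \<le> C * (\<integral>s. \<bar>h s\<bar> \<partial>lborel)" for \<zeta>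
  proof -
    have "\<bar>K \<zeta>\<bar> \<le> (\<integral>s. C * \<bar>h s\<bar> \<partial>lborel)"
      unfolding K_def real_norm_def[symmetric] by (rule Bochner_Integration.integral_norm_bound_integral)
         (use h h_prod hb in \<open>auto simp: abs_mult\<close>)
    then show ?thesis by simp
  qed
  \<comment> \<open>The difference is at most \<open>C\<close> times the L1 distance between
    \<open>h\<close> and its translate.\<close>
  have K_cont: "(\<lambda>n. K (a n *\<^sub>R \<eta>)) \<longlonglongrightarrow> K 0" for \<eta>
  proof -
    have "(\<lambda>n. a n *\<^sub>R \<eta>) \<longlonglongrightarrow> 0 *\<^sub>R \<eta>" by (intro tendsto_intros a_lim)
    then have "(\<lambda>n. \<integral>\<^sup>+s. ennreal \<bar>h (s + a n *\<^sub>R \<eta>) - h s\<bar> \<partial>lborel) \<longlonglongrightarrow> 0"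
      by (intro translation_continuous_L1[OF h]) simp
    then have "(\<lambda>n. ennreal C * (\<integral>\<^sup>+s. ennreal \<bar>h (s + a n *\<^sub>R \<eta>) - h s\<bar> \<partial>lborel)) \<longlonglongrightarrow> ennreal C * 0"
      by (intro ennreal_tendsto_cmult) auto
    then have lim: "(\<lambda>n. ennreal C * (\<integral>\<^sup>+s. ennreal \<bar>h (s + a n *\<^sub>R \<eta>) - h s\<bar> \<partial>lborel)) \<longlonglongrightarrow> 0" by simp
    have le: "ennreal \<bar>K (a n *\<^sub>R \<eta>) - K 0\<bar> \<le> ennreal C * (\<integral>\<^sup>+s. ennreal \<bar>h (s + a n *\<^sub>R \<eta>) - h s\<bar> \<partial>lborel)" for n
    proof -
      have "K (a n *\<^sub>R \<eta>) - K 0 = (\<integral>s. h s * h (a n *\<^sub>R \<eta> + s) - h s * h (0 + s) \<partial>lborel)"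
        unfolding K_def by (rule Bochner_Integration.integral_diff[symmetric]) (rule h_prod)+
      also have "ennreal (norm \<dots>) \<le> (\<integral>\<^sup>+s. ennreal (norm (h s * h (a n *\<^sub>R \<eta> + s) - h s * h (0 + s))) \<partial>lborel)"
        by (rule integral_norm_bound_ennreal) (rule Bochner_Integration.integrable_diff h_prod)+
      also have "\<dots> \<le> (\<integral>\<^sup>+s. ennreal C * ennreal \<bar>h (s + a n *\<^sub>R \<eta>) - h s\<bar> \<partial>lborel)"
        using bnd C by (intro nn_integral_mono)
          (auto simp flip: ennreal_mult right_diff_distrib simp: abs_mult add.commute intro!: ennreal_leI mult_right_mono)
      also have "\<dots> = ennreal C * (\<integral>\<^sup>+s. ennreal \<bar>h (s + a n *\<^sub>R \<eta>) - h s\<bar> \<partial>lborel)"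
        by (rule nn_integral_cmult) measurable
      finally show ?thesis by simp
    qed
    have "(\<lambda>n. ennreal \<bar>K (a n *\<^sub>R \<eta>) - K 0\<bar>) \<longlonglongrightarrow> 0"
      by (rule tendsto_sandwich[OF _ always_eventually[OF allI[OF le]] tendsto_const lim]) simp
    then have "(\<lambda>n. \<bar>K (a n *\<^sub>R \<eta>) - K 0\<bar>) \<longlonglongrightarrow> 0"
      by (subst (asm) ennreal_0[symmetric], subst (asm) tendsto_ennreal_iff) auto
    then show ?thesis by (simp add: tendsto_rabs_zero_iff LIM_zero_iff)
  qed
  have "(\<lambda>n. \<integral>\<eta>. K (a n *\<^sub>R \<eta>) * exp (- (1 * norm \<eta>)\<^sup>2 / 2) \<partial>lborel) \<longlonglongrightarrow> (\<integral>\<eta>. K 0 * exp (- (1 * norm \<eta>)\<^sup>2 / 2) \<partial>(lborel::'a measure))"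
  proof (rule integral_dominated_convergence[where w="\<lambda>\<eta>::'a. (C * (\<integral>s. \<bar>h s\<bar> \<partial>lborel)) * exp (- (1 * norm \<eta>)\<^sup>2 / 2)"])
    show "integrable lborel (\<lambda>\<eta>::'a. (C * (\<integral>s. \<bar>h s\<bar> \<partial>lborel)) * exp (- (1 * norm \<eta>)\<^sup>2 / 2))"
      by (intro integrable_mult_right gaussian_integrable) simp
    show "AE \<eta> in lborel. (\<lambda>n. K (a n *\<^sub>R \<eta>) * exp (- (1 * norm \<eta>)\<^sup>2 / 2)) \<longlonglongrightarrow> K 0 * exp (- (1 * norm \<eta>)\<^sup>2 / 2)"
      by (intro AE_I2 tendsto_intros K_cont)
    show "AE \<eta> in lborel. norm (K (a n *\<^sub>R \<eta>) * exp (- (1 * norm \<eta>)\<^sup>2 / 2)) \<le> (C * (\<integral>s. \<bar>h s\<bar> \<partial>lborel)) * exp (- (1 * norm \<eta>)\<^sup>2 / 2)" for n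
      using K_bound by (intro AE_I2) (auto simp: abs_mult intro!: mult_right_mono)
  qed measurable
  also have "(\<integral>\<eta>. K 0 * exp (- (1 * norm \<eta>)\<^sup>2 / 2) \<partial>(lborel::'a measure)) = K 0 * sqrt (2 * pi) ^ DIM('a)"
    using gaussian_integrable(2)[of 1, where 'a='a] by simp
  finally have "(\<lambda>n. sqrt (2 * pi) ^ DIM('a) * (\<integral>\<eta>. K (a n *\<^sub>R \<eta>) * exp (- (1 * norm \<eta>)\<^sup>2 / 2) \<partial>lborel)) \<longlonglongrightarrow> sqrt (2 * pi) ^ DIM('a) * (K 0 * sqrt (2 * pi) ^ DIM('a))"
    by (rule tendsto_mult_left)
  moreover have "sqrt (2 * pi) ^ DIM('a) * (K 0 * sqrt (2 * pi) ^ DIM('a)) = (2 * pi) ^ DIM('a) * K 0"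
  proof -
    have "sqrt (2 * pi) ^ DIM('a) * sqrt (2 * pi) ^ DIM('a) = (2 * pi) ^ DIM('a)"
      unfolding power_mult_distrib[symmetric] by simp
    then show ?thesis by (metis mult.assoc mult.commute)
  qed
  ultimately have lim: "(\<lambda>n. \<integral>\<sigma>. exp (- (a n * norm \<sigma>)\<^sup>2 / 2) * (norm (fourier h \<sigma>))\<^sup>2 \<partial>lborel) \<longlonglongrightarrow> (2 * pi) ^ DIM('a) * K 0"
    by (simp only: smoothed[OF a_pos])
  have fb: "norm (fourier h \<sigma>) \<le> (\<integral>s. \<bar>h s\<bar> \<partial>lborel)" for \<sigma>
    unfolding fourier_def using integral_norm_bound[of lborel "\<lambda>s. h s *\<^sub>R cis (- (s \<bullet> \<sigma>))"] by simp
  have int_n: "integrable lborel (\<lambda>\<sigma>. exp (- (a n * norm \<sigma>)\<^sup>2 / 2) * (norm (fourier h \<sigma>))\<^sup>2)" for n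
  proof (rule Bochner_Integration.integrable_bound[OF integrable_mult_left[OF gaussian_integrable(1)[OF a_pos[of n]], of "(\<integral>s. \<bar>h s\<bar> \<partial>lborel)\<^sup>2"]])
    show "AE \<sigma> in lborel. norm (exp (- (a n * norm \<sigma>)\<^sup>2 / 2) * (norm (fourier h \<sigma>))\<^sup>2) \<le> norm (exp (- (a n * norm \<sigma>)\<^sup>2 / 2) * (\<integral>s. \<bar>h s\<bar> \<partial>lborel)\<^sup>2)"
      using fb by (auto intro!: power_mono)
  qed measurable
  have nn: "(\<integral>\<^sup>+\<sigma>. ennreal (exp (- (a n * norm \<sigma>)\<^sup>2 / 2) * (norm (fourier h \<sigma>))\<^sup>2) \<partial>lborel)
      = ennreal (\<integral>\<sigma>. exp (- (a n * norm \<sigma>)\<^sup>2 / 2) * (norm (fourier h \<sigma>))\<^sup>2 \<partial>lborel)" for n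
    by (rule nn_integral_eq_integral[OF int_n]) simp
  have a_mono: "a n \<le> a m" if "m \<le> n" for m n
    using that by (simp add: a_def frac_le)
  \<comment> \<open>\<open>a\<close> decreases to 0, so the damping factors increase to 1 and
    monotone convergence applies.\<close>
  have "(\<lambda>n. \<integral>\<^sup>+\<sigma>. ennreal (exp (- (a n * norm \<sigma>)\<^sup>2 / 2) * (norm (fourier h \<sigma>))\<^sup>2) \<partial>lborel) \<longlonglongrightarrow> (\<integral>\<^sup>+\<sigma>. ennreal ((norm (fourier h \<sigma>))\<^sup>2) \<partial>lborel)"
  proof (rule nn_integral_LIMSEQ)
    show "incseq (\<lambda>n \<sigma>. ennreal (exp (- (a n * norm \<sigma>)\<^sup>2 / 2) * (norm (fourier h \<sigma>))\<^sup>2))"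
      using a_mono a_pos by (auto simp: incseq_def le_fun_def less_imp_le intro!: ennreal_leI mult_right_mono power_mono)
    fix \<sigma>
    have "(\<lambda>n. exp (- (a n * norm \<sigma>)\<^sup>2 / 2) * (norm (fourier h \<sigma>))\<^sup>2) \<longlonglongrightarrow> exp (- (0 * norm \<sigma>)\<^sup>2 / 2) * (norm (fourier h \<sigma>))\<^sup>2"
      by (intro tendsto_intros a_lim) simp
    then show "(\<lambda>n. ennreal (exp (- (a n * norm \<sigma>)\<^sup>2 / 2) * (norm (fourier h \<sigma>))\<^sup>2)) \<longlonglongrightarrow> ennreal ((norm (fourier h \<sigma>))\<^sup>2)"
      by (intro tendsto_ennrealI) simp
  qed measurable
  moreover have "(\<lambda>n. \<integral>\<^sup>+\<sigma>. ennreal (exp (- (a n * norm \<sigma>)\<^sup>2 / 2) * (norm (fourier h \<sigma>))\<^sup>2) \<partial>lborel) \<longlonglongrightarrow> ennreal ((2 * pi) ^ DIM('a) * K 0)"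
    unfolding nn by (intro tendsto_ennrealI lim)
  ultimately have "(\<integral>\<^sup>+\<sigma>. ennreal ((norm (fourier h \<sigma>))\<^sup>2) \<partial>lborel) = ennreal ((2 * pi) ^ DIM('a) * K 0)"
    by (rule LIMSEQ_unique)
  moreover have "ennreal (K 0) = (\<integral>\<^sup>+x. ennreal ((h x)\<^sup>2) \<partial>lborel)"
    unfolding K_def using h_prod[of 0] by (subst nn_integral_eq_integral) (auto simp: power2_eq_square)
  moreover have "K 0 \<ge> 0" unfolding K_def by (intro Bochner_Integration.integral_nonneg) simp
  ultimately show ?thesis by (simp add: ennreal_mult)
qed

section \<open>A Gaussian-averaged oscillatory integral\<close>

lemma borel_measurable_fst_borel [measurable]:
  "fst \<in> measurable (borel :: ('a::second_countable_topology \<times> 'b::second_countable_topology) measure) borel"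
  by (intro borel_measurable_continuous_onI continuous_intros)

lemma borel_measurable_snd_borel [measurable]:
  "snd \<in> measurable (borel :: ('a::second_countable_topology \<times> 'b::second_countable_topology) measure) borel"
  by (intro borel_measurable_continuous_onI continuous_intros)

lemma borel_measurable_cnj [measurable (raw)]:
  "f \<in> borel_measurable M \<Longrightarrow> (\<lambda>x. cnj (f x)) \<in> borel_measurable M"
  by (rule measurable_compose[of f M borel cnj]) (auto intro!: borel_measurable_continuous_onI continuous_intros)

lemma complex_norm_mult_le_sum_squares: "norm (x * cnj y) \<le> (norm x)\<^sup>2 / 2 + (norm y)\<^sup>2 / 2"
  using sum_squares_bound[of "norm x" "norm y"] by (simp add: norm_mult)

text \<open>The square of the oscillatory integral is a double integral over \<open>(w, w')\<close>; integrating over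
  \<open>v\<close> first leaves the positive kernel \<open>exp (- (r * norm (w - w'))\<^sup>2 / 2)\<close>, to which Schur's test
  applies.\<close>

lemma gaussian_oscillatory_bound:
  fixes a :: "'b::euclidean_space \<Rightarrow> complex" and L :: "'b \<Rightarrow> 'a::euclidean_space"
  assumes a: "integrable lborel a" and L: "linear L" and norm_L: "\<And>w. norm (L w) = r * norm w" and r: "r > 0"
  shows "(\<integral>\<^sup>+v. ennreal (exp (- (norm v)\<^sup>2 / 2) * (norm (\<integral>w. a w * cis (v \<bullet> L w) \<partial>lborel))\<^sup>2) \<partial>lborel)
    \<le> ennreal (sqrt (2 * pi) ^ DIM('a) * (sqrt (2 * pi) / r) ^ DIM('b)) * (\<integral>\<^sup>+w. ennreal ((norm (a w))\<^sup>2) \<partial>lborel)"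
proof -
  let ?P = "lborel \<Otimes>\<^sub>M lborel :: ('b \<times> 'b) measure"
  define A where "A v = (\<integral>w. a w * cis (v \<bullet> L w) \<partial>lborel)" for v
  define b where "b p = a (fst p) * cnj (a (snd p))" for p
  define e where "e v = exp (- (1 * norm v)\<^sup>2 / 2)" for v :: 'a
  define G where "G w = exp (- (r * norm w)\<^sup>2 / 2)" for w :: 'b
  have [measurable]: "a \<in> borel_measurable borel"
    using borel_measurable_integrable[OF a] by simp
  have [measurable]: "L \<in> borel_measurable borel"
    using L by (intro borel_measurable_continuous_onI linear_continuous_on linear_conv_bounded_linear[THEN iffD1])
  have [measurable]: "e \<in> borel_measurable borel" "G \<in> borel_measurable borel"
    unfolding e_def G_def by measurable
  have [measurable]: "A \<in> borel_measurable borel" unfolding A_def by measurable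
  have b_meas[measurable]: "b \<in> borel_measurable ?P" unfolding b_def by measurable
  have b_int: "integrable ?P b"
    by (rule integrable_lborel_pair_bound[OF b_meas integrable_norm[OF a] integrable_norm[OF a]])
       (simp add: b_def norm_mult)
  have e_int: "integrable lborel e" unfolding e_def by (rule gaussian_integrable) simp
  have cis_diff: "cis (x - y) = cis x * cis (- y)" for x y
    by (simp add: cis_mult)
  have square: "complex_of_real ((norm (A v))\<^sup>2) = (\<integral>p. b p * cis (v \<bullet> L (fst p - snd p)) \<partial>?P)" for v
  proof -
    have cnj: "cnj (A v) = (\<integral>w. cnj (a w) * cis (- (v \<bullet> L w)) \<partial>lborel)"
      unfolding A_def by (subst Bochner_Integration.integral_cnj[symmetric]) (simp add: cis_cnj)
    have "complex_of_real ((norm (A v))\<^sup>2) = A v * cnj (A v)"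
      by (rule complex_norm_square)
    also have "\<dots> = (\<integral>w. (a w * cis (v \<bullet> L w)) * cnj (A v) \<partial>lborel)"
      unfolding A_def by (rule integral_mult_left_zero[symmetric])
    also have "\<dots> = (\<integral>w. (\<integral>w'. (a w * cis (v \<bullet> L w)) * (cnj (a w') * cis (- (v \<bullet> L w'))) \<partial>lborel) \<partial>lborel)"
      unfolding cnj by simp
    also have "\<dots> = (\<integral>w. (\<integral>w'. b (w, w') * cis (v \<bullet> L (fst (w, w') - snd (w, w'))) \<partial>lborel) \<partial>lborel)"
      by (intro Bochner_Integration.integral_cong refl)
         (simp add: b_def linear_diff[OF L] inner_diff_right cis_diff mult_ac)
    also have "\<dots> = (\<integral>p. b p * cis (v \<bullet> L (fst p - snd p)) \<partial>?P)"
    proof (rule lborel_pair.integral_fst')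
      show "integrable ?P (\<lambda>p. b p * cis (v \<bullet> L (fst p - snd p)))"
        by (rule Bochner_Integration.integrable_bound[OF b_int]) (auto simp: norm_mult)
    qed
    finally show ?thesis .
  qed
  have A_bound: "norm (A v) \<le> (\<integral>w. norm (a w) \<partial>lborel)" for v
    unfolding A_def using integral_norm_bound[of lborel "\<lambda>w. a w * cis (v \<bullet> L w)"] by (simp add: norm_mult)
  have int_v: "integrable lborel (\<lambda>v. e v * (norm (A v))\<^sup>2)"
  proof (rule Bochner_Integration.integrable_bound[OF integrable_mult_left[OF e_int, of "(\<integral>w. norm (a w) \<partial>lborel)\<^sup>2"]])
    show "AE v in lborel. norm (e v * (norm (A v))\<^sup>2) \<le> norm (e v * (\<integral>w. norm (a w) \<partial>lborel)\<^sup>2)"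
      using A_bound by (auto simp: abs_mult intro!: mult_left_mono power_mono)
  qed measurable
  interpret vp: pair_sigma_finite "lborel :: 'a measure" ?P
    by (intro pair_sigma_finite.intro lborel.sigma_finite_measure_axioms) (simp add: lborel_prod lborel.sigma_finite_measure_axioms)
  have int_vp: "integrable (lborel \<Otimes>\<^sub>M ?P) (\<lambda>(v, p). e v *\<^sub>R (b p * cis (v \<bullet> L (fst p - snd p))))"
  proof (rule vp.Fubini_integrable)
    show "integrable lborel (\<lambda>v. \<integral>p. norm (case (v, p) of (v, p) \<Rightarrow> e v *\<^sub>R (b p * cis (v \<bullet> L (fst p - snd p)))) \<partial>?P)"
      using e_int by (simp add: norm_mult)
    show "AE v in lborel. integrable ?P (\<lambda>p. case (v, p) of (v, p) \<Rightarrow> e v *\<^sub>R (b p * cis (v \<bullet> L (fst p - snd p))))"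
    proof (rule AE_I2)
      fix v
      show "integrable ?P (\<lambda>p. case (v, p) of (v, p) \<Rightarrow> e v *\<^sub>R (b p * cis (v \<bullet> L (fst p - snd p))))"
        by (rule Bochner_Integration.integrable_bound[OF integrable_mult_right[OF b_int, of "complex_of_real (e v)"]])
           (auto simp: norm_mult)
    qed
  qed measurable
  have "complex_of_real (\<integral>v. e v * (norm (A v))\<^sup>2 \<partial>lborel) = (\<integral>v. complex_of_real (e v * (norm (A v))\<^sup>2) \<partial>lborel)"
    by (rule integral_complex_of_real[symmetric])
  also have "\<dots> = (\<integral>v. (\<integral>p. e v *\<^sub>R (b p * cis (v \<bullet> L (fst p - snd p))) \<partial>?P) \<partial>lborel)"
    by (simp only: of_real_mult square integral_scaleR_right) (simp add: scaleR_conv_of_real)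
  also have "\<dots> = (\<integral>p. (\<integral>v. e v *\<^sub>R (b p * cis (v \<bullet> L (fst p - snd p))) \<partial>lborel) \<partial>?P)"
    by (rule vp.Fubini_integral[symmetric, OF int_vp])
  also have "\<dots> = (\<integral>p. b p * of_real (sqrt (2 * pi) ^ DIM('a) * G (fst p - snd p)) \<partial>?P)"
  proof (intro Bochner_Integration.integral_cong refl)
    fix p
    have "(\<integral>v. e v *\<^sub>R (b p * cis (v \<bullet> L (fst p - snd p))) \<partial>lborel) = b p * (\<integral>v. exp (- (1 * norm v)\<^sup>2 / 2) *\<^sub>R cis (v \<bullet> L (fst p - snd p)) \<partial>lborel)"
      by (subst integral_mult_right_zero[symmetric]) (simp add: e_def)
    also have "\<dots> = b p * of_real ((sqrt (2 * pi) / 1) ^ DIM('a) * exp (- (norm (L (fst p - snd p)) / 1)\<^sup>2 / 2))"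
      by (subst has_bochner_integral_integral_eq[OF gaussian_fourier[of 1]]) simp_all
    finally show "(\<integral>v. e v *\<^sub>R (b p * cis (v \<bullet> L (fst p - snd p))) \<partial>lborel) = b p * of_real (sqrt (2 * pi) ^ DIM('a) * G (fst p - snd p))"
      by (simp add: norm_L G_def)
  qed
  finally have eq: "complex_of_real (\<integral>v. e v * (norm (A v))\<^sup>2 \<partial>lborel) = (\<integral>p. b p * of_real (sqrt (2 * pi) ^ DIM('a) * G (fst p - snd p)) \<partial>?P)" .
  have int_G: "integrable ?P (\<lambda>p. b p * of_real (sqrt (2 * pi) ^ DIM('a) * G (fst p - snd p)))"
    by (rule Bochner_Integration.integrable_bound[OF integrable_mult_left[OF b_int, of "of_real (sqrt (2 * pi) ^ DIM('a))"]])
       (auto simp: norm_mult G_def abs_mult intro!: AE_I2 mult_left_mono mult_left_le)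
  let ?c = "ennreal (sqrt (2 * pi) ^ DIM('a))"
  let ?q = "\<lambda>w. ennreal ((norm (a w))\<^sup>2 / 2)"
  have G_nn: "(\<integral>\<^sup>+w. ennreal (G w) \<partial>lborel) = ennreal ((sqrt (2 * pi) / r) ^ DIM('b))"
    unfolding G_def using gaussian_integrable[OF r, where 'a='b] by (subst nn_integral_eq_integral) auto
  have G_sym: "G (w - w') = G (w' - w)" for w w' by (simp add: G_def norm_minus_commute)
  have G_nonneg: "G w \<ge> 0" for w by (simp add: G_def)
  have G_tr: "(\<integral>\<^sup>+w. ennreal (G (w - w')) \<partial>lborel) = ennreal ((sqrt (2 * pi) / r) ^ DIM('b))" for w'
    using nn_integral_lborel_translation[of "\<lambda>w. ennreal (G w)" "- w'"] G_nn by simp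
  have G_tr': "(\<integral>\<^sup>+w'. ennreal (G (w - w')) \<partial>lborel) = ennreal ((sqrt (2 * pi) / r) ^ DIM('b))" for w
    using G_tr[of w] by (simp only: G_sym[of w])
  have "(\<integral>\<^sup>+v. ennreal (e v * (norm (A v))\<^sup>2) \<partial>lborel) = ennreal (\<integral>v. e v * (norm (A v))\<^sup>2 \<partial>lborel)"
    by (rule nn_integral_eq_integral[OF int_v]) (simp add: e_def)
  also have "\<dots> = ennreal (norm (complex_of_real (\<integral>v. e v * (norm (A v))\<^sup>2 \<partial>lborel)))"
    by (subst norm_of_real, subst abs_of_nonneg) (auto intro!: Bochner_Integration.integral_nonneg simp: e_def)
  also have "\<dots> \<le> (\<integral>\<^sup>+p. ennreal (norm (b p * of_real (sqrt (2 * pi) ^ DIM('a) * G (fst p - snd p)))) \<partial>?P)"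
    unfolding eq by (rule integral_norm_bound_ennreal[OF int_G])
  \<comment> \<open>Schur's test for a convolution kernel: the product of the two moduli is at most
    half the sum of their squares, and in each half the other variable integrates out to the total
    mass \<open>(sqrt (2 * pi) / r) ^ DIM('b)\<close> of \<open>G\<close>.\<close>
  also have "\<dots> \<le> (\<integral>\<^sup>+p. ?c * (?q (fst p) * ennreal (G (fst p - snd p)) + ?q (snd p) * ennreal (G (fst p - snd p))) \<partial>?P)"
  proof (rule nn_integral_mono)
    fix p
    have "norm (b p * of_real (sqrt (2 * pi) ^ DIM('a) * G (fst p - snd p)))
       \<le> ((norm (a (fst p)))\<^sup>2 / 2 + (norm (a (snd p)))\<^sup>2 / 2) * (sqrt (2 * pi) ^ DIM('a) * G (fst p - snd p))"
    proof -
      have "norm (b p * of_real (sqrt (2 * pi) ^ DIM('a) * G (fst p - snd p))) = norm (b p) * (sqrt (2 * pi) ^ DIM('a) * G (fst p - snd p))"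
        by (simp add: norm_mult norm_power G_nonneg)
      then show ?thesis
        unfolding b_def by (simp only:) (intro mult_right_mono complex_norm_mult_le_sum_squares, simp add: G_nonneg)
    qed
    also have "ennreal \<dots> = ?c * (?q (fst p) * ennreal (G (fst p - snd p)) + ?q (snd p) * ennreal (G (fst p - snd p)))"
    proof -
      have "((norm (a (fst p)))\<^sup>2 / 2 + (norm (a (snd p)))\<^sup>2 / 2) * (sqrt (2 * pi) ^ DIM('a) * G (fst p - snd p))
         = sqrt (2 * pi) ^ DIM('a) * ((norm (a (fst p)))\<^sup>2 / 2 * G (fst p - snd p) + (norm (a (snd p)))\<^sup>2 / 2 * G (fst p - snd p))"
        by (simp add: algebra_simps)
      then show ?thesis
        by (simp only: ennreal_mult ennreal_plus G_nonneg zero_le_power2 divide_nonneg_pos zero_less_numeral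
            mult_nonneg_nonneg add_nonneg_nonneg zero_le_power real_sqrt_ge_zero pi_ge_zero zero_le_numeral)
    qed
    finally show "ennreal (norm (b p * of_real (sqrt (2 * pi) ^ DIM('a) * G (fst p - snd p)))) \<le> ?c * (?q (fst p) * ennreal (G (fst p - snd p)) + ?q (snd p) * ennreal (G (fst p - snd p)))"
      by (simp add: ennreal_leI)
  qed
  also have "\<dots> = ?c * ((\<integral>\<^sup>+p. ?q (fst p) * ennreal (G (fst p - snd p)) \<partial>?P) + (\<integral>\<^sup>+p. ?q (snd p) * ennreal (G (fst p - snd p)) \<partial>?P))"
    by (subst nn_integral_cmult, measurable, subst nn_integral_add, measurable)
  also have "(\<integral>\<^sup>+p. ?q (fst p) * ennreal (G (fst p - snd p)) \<partial>?P) = (\<integral>\<^sup>+w. (\<integral>\<^sup>+w'. ?q w * ennreal (G (w - w')) \<partial>lborel) \<partial>lborel)"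
    by (subst lborel.nn_integral_fst[symmetric]) auto
  also have "\<dots> = (\<integral>\<^sup>+w. ?q w \<partial>lborel) * ennreal ((sqrt (2 * pi) / r) ^ DIM('b))"
    by (simp add: nn_integral_cmult nn_integral_multc G_tr')
  also have "(\<integral>\<^sup>+p. ?q (snd p) * ennreal (G (fst p - snd p)) \<partial>?P) = (\<integral>\<^sup>+w'. (\<integral>\<^sup>+w. ?q w' * ennreal (G (w - w')) \<partial>lborel) \<partial>lborel)"
    by (subst lborel_pair.nn_integral_snd[symmetric]) auto
  also have "\<dots> = (\<integral>\<^sup>+w. ?q w \<partial>lborel) * ennreal ((sqrt (2 * pi) / r) ^ DIM('b))"
    by (simp add: nn_integral_cmult nn_integral_multc G_tr)
  also have "(\<integral>\<^sup>+w. ?q w \<partial>lborel) * ennreal ((sqrt (2 * pi) / r) ^ DIM('b)) + (\<integral>\<^sup>+w. ?q w \<partial>lborel) * ennreal ((sqrt (2 * pi) / r) ^ DIM('b))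
     = ((\<integral>\<^sup>+w. ?q w \<partial>lborel) + (\<integral>\<^sup>+w. ?q w \<partial>lborel)) * ennreal ((sqrt (2 * pi) / r) ^ DIM('b))"
    by (rule distrib_right[symmetric])
  also have "(\<integral>\<^sup>+w. ?q w \<partial>lborel) + (\<integral>\<^sup>+w. ?q w \<partial>lborel) = (\<integral>\<^sup>+w. ennreal ((norm (a w))\<^sup>2) \<partial>lborel)"
    by (subst nn_integral_add[symmetric]) (auto simp flip: ennreal_plus)
  also have "?c * ((\<integral>\<^sup>+w. ennreal ((norm (a w))\<^sup>2) \<partial>lborel) * ennreal ((sqrt (2 * pi) / r) ^ DIM('b)))
     = ennreal (sqrt (2 * pi) ^ DIM('a) * (sqrt (2 * pi) / r) ^ DIM('b)) * (\<integral>\<^sup>+w. ennreal ((norm (a w))\<^sup>2) \<partial>lborel)"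
    using r by (simp add: ennreal_mult mult_ac)
  finally show ?thesis by (simp add: e_def A_def)
qed

section \<open>Smoothing along the orthogonality relation\<close>

definition bil :: "complex \<times> complex \<Rightarrow> complex \<times> complex \<Rightarrow> complex" where
  "bil v w = fst v * fst w + snd v * snd w"

text \<open>The adjoint of \<open>\<lambda>v. bil v w\<close> for the real inner products, applied
  to \<sigma>. The pairing \<open>bil\<close> has no conjugates, so they appear here.\<close>

definition freq :: "complex \<Rightarrow> complex \<times> complex \<Rightarrow> complex \<times> complex" where
  "freq \<sigma> w = (\<sigma> * cnj (fst w), \<sigma> * cnj (snd w))"

lemma inner_bil: "bil v w \<bullet> \<sigma> = v \<bullet> freq \<sigma> w"
  by (cases v) (simp add: bil_def freq_def inner_prod_def inner_complex_def algebra_simps)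

text \<open>In \<open>w\<close> this is a similarity of ratio \<open>norm \<sigma>\<close>, so no
  direction of \<open>w\<close> is degenerate and the oscillatory bound gains the full power of
  \<open>norm \<sigma>\<close>.\<close>

lemma norm_freq: "norm (freq \<sigma> w) = norm \<sigma> * norm w"
  by (cases w) (simp add: freq_def norm_Pair norm_mult power_mult_distrib real_sqrt_mult flip: distrib_left)

lemma linear_freq: "linear (freq \<sigma>)"
  by (rule linearI) (auto simp: freq_def algebra_simps scaleR_conv_of_real)

lemma norm_bil_le: "norm (bil v w) \<le> 2 * (norm v * norm w)"
proof -
  have "norm (bil v w) \<le> norm (fst v) * norm (fst w) + norm (snd v) * norm (snd w)"
    unfolding bil_def by (metis norm_mult norm_triangle_ineq)
  also have "\<dots> \<le> norm v * norm w + norm v * norm w"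
    by (intro add_mono mult_mono norm_fst_le norm_snd_le norm_ge_zero)
       (metis norm_fst_le norm_snd_le prod.collapse)+
  finally show ?thesis by simp
qed

lemma borel_measurable_bil [measurable]:
  assumes [measurable]: "f \<in> borel_measurable M" "g \<in> borel_measurable M"
  shows "(\<lambda>x. bil (f x) (g x)) \<in> borel_measurable M"
  unfolding bil_def by measurable

lemma borel_measurable_freq [measurable]:
  assumes [measurable]: "f \<in> borel_measurable M" "g \<in> borel_measurable M"
  shows "(\<lambda>x. freq (f x) (g x)) \<in> borel_measurable M"
  unfolding freq_def by measurable

lemma fourier_translation:
  fixes h :: "'a::euclidean_space \<Rightarrow> real"
  assumes [measurable]: "h \<in> borel_measurable borel"
  shows "fourier (\<lambda>s. h (s + c)) \<sigma> = cis (c \<bullet> \<sigma>) * fourier h \<sigma>"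
proof -
  have "fourier (\<lambda>s. h (s + c)) \<sigma> = (\<integral>s. h (s + c) *\<^sub>R cis (- ((s + c - c) \<bullet> \<sigma>)) \<partial>lborel)"
    by (simp add: fourier_def)
  also have "\<dots> = (\<integral>s. h s *\<^sub>R cis (- ((s - c) \<bullet> \<sigma>)) \<partial>lborel)"
    by (rule integral_lborel_translation) measurable
  also have "\<dots> = (\<integral>s. cis (c \<bullet> \<sigma>) * (h s *\<^sub>R cis (- (s \<bullet> \<sigma>))) \<partial>lborel)"
    by (simp add: inner_diff_left cis_mult)
  also have "\<dots> = cis (c \<bullet> \<sigma>) * fourier h \<sigma>"
    unfolding fourier_def by (rule integral_mult_right_zero)
  finally show ?thesis .
qed

lemma norm_fourier_le:
  fixes h :: "'a::euclidean_space \<Rightarrow> real"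
  shows "norm (fourier h \<sigma>) \<le> (\<integral>s. \<bar>h s\<bar> \<partial>lborel)"
  unfolding fourier_def using integral_norm_bound[of lborel "\<lambda>s. h s *\<^sub>R cis (- (s \<bullet> \<sigma>))"] by simp

text \<open>Models the encoder or decoder function of one message after the cut-off, and also their
  second differences; for the latter \<open>C\<close> and \<open>R\<close> have to be parameters.
  Boundedness and bounded support supply all integrability below.\<close>

locale bounded_kernel =
  fixes h :: "complex \<times> complex \<times> complex \<Rightarrow> real" and C R :: real
  assumes h_meas [measurable]: "h \<in> borel_measurable borel"
    and h_bound: "\<And>p. \<bar>h p\<bar> \<le> C"
    and h_supp: "\<And>t w. R < norm t \<or> R < norm w \<Longrightarrow> h (t, w) = 0"
begin

text \<open>A complex Radon transform: the integral of \<open>h\<close> over the hyperplane t = s +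
  v \<cdot> w, that is, over all \<phi> orthogonal to the \<psi> with parameters
  \<open>(s, v)\<close>.\<close>

definition U :: "complex \<Rightarrow> complex \<times> complex \<Rightarrow> real" where
  "U s v = (\<integral>w. h (s + bil v w, w) \<partial>lborel)"

definition F :: "complex \<times> complex \<Rightarrow> complex \<Rightarrow> complex" where
  "F w \<sigma> = fourier (\<lambda>t. h (t, w)) \<sigma>"

lemma C_nonneg: "C \<ge> 0"
  using h_bound[of 0] by linarith

lemma h_le: "\<bar>h (t, w)\<bar> \<le> (C * indicator (cball 0 R) t) * indicator (cball 0 R) w"
  using h_bound[of "(t, w)"] h_supp[of t w] by (auto simp: indicator_def not_le)

lemma h_le_fst: "\<bar>h (t, w)\<bar> \<le> C * indicator (cball 0 R) t"
  using h_bound[of "(t, w)"] h_supp[of t w] by (auto simp: indicator_def not_le)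

lemma h_le_snd: "\<bar>h (t, w)\<bar> \<le> C * indicator (cball 0 R) w"
  using h_bound[of "(t, w)"] h_supp[of t w] by (auto simp: indicator_def not_le)

lemma integrable_indicator_cball: "integrable lborel (\<lambda>x::'a::euclidean_space. (indicator (cball 0 R) x :: real))"
  using emeasure_lborel_cball_finite by (auto intro!: integrable_real_indicator)

lemma h_integrable: "integrable (lborel \<Otimes>\<^sub>M lborel) h"
  by (rule integrable_lborel_pair_bound[where g="\<lambda>t. C * indicator (cball 0 R) t" and k="indicator (cball 0 R)"])
     (auto simp: h_le borel_prod lborel_prod intro: integrable_indicator_cball)

lemma integrable_abs_snd: "integrable lborel (\<lambda>w. \<integral>s. \<bar>h (s, w)\<bar> \<partial>lborel)"
proof (rule lborel_pair.integrable_snd)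
  show "integrable (lborel \<Otimes>\<^sub>M lborel) (\<lambda>(s, w). \<bar>h (s, w)\<bar>)"
    using integrable_abs[OF h_integrable] by (simp add: case_prod_unfold)
qed

lemma h_integrable_fst: "integrable lborel (\<lambda>t. h (t, w))"
  by (rule Bochner_Integration.integrable_bound[OF integrable_mult_right[OF integrable_indicator_cball, of C]])
     (use h_le_fst[of _ w] in \<open>auto intro!: AE_I2 order_trans[OF _ abs_ge_self]\<close>)

lemma h_integrable_snd: "integrable lborel (\<lambda>w. h (s + bil v w, w))"
  by (rule Bochner_Integration.integrable_bound[OF integrable_mult_right[OF integrable_indicator_cball, of C]])
     (use h_le_snd in \<open>auto intro!: AE_I2 order_trans[OF _ abs_ge_self]\<close>)

lemma U_meas [measurable]: "(\<lambda>p. U (fst p) (snd p)) \<in> borel_measurable borel"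
  unfolding U_def by measurable

lemma U_meas_pair [measurable (raw)]:
  assumes [measurable]: "f \<in> borel_measurable M" "g \<in> borel_measurable M"
  shows "(\<lambda>x. U (f x) (g x)) \<in> borel_measurable M"
  using measurable_compose[OF _ U_meas, of "\<lambda>x. (f x, g x)" M] by simp

lemma F_meas_pair [measurable (raw)]:
  assumes [measurable]: "f \<in> borel_measurable M" "g \<in> borel_measurable M"
  shows "(\<lambda>x. F (f x) (g x)) \<in> borel_measurable M"
  unfolding F_def fourier_def by measurable

lemma U_bound: "\<bar>U s v\<bar> \<le> C * measure lborel (cball (0 :: complex \<times> complex) R)"
proof -
  have "\<bar>U s v\<bar> \<le> (\<integral>w. C * indicator (cball 0 R) w \<partial>(lborel :: (complex \<times> complex) measure))"
    unfolding U_def real_norm_def[symmetric]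
  proof (rule Bochner_Integration.integral_norm_bound_integral[OF h_integrable_snd integrable_mult_right[OF integrable_indicator_cball]])
    fix w show "norm (h (s + bil v w, w)) \<le> C * indicator (cball 0 R) w"
      using h_le_snd by simp
  qed
  then show ?thesis by simp
qed

text \<open>For fixed \<open>w\<close> the shear is a translation in \<open>s\<close>, which leaves
  the L1 norm unchanged.\<close>

lemma integrable_shear: "integrable (lborel \<Otimes>\<^sub>M lborel) (\<lambda>(w, s). h (s + bil v w, w))"
proof (rule lborel_pair.Fubini_integrable)
  have "(\<integral>s. \<bar>h (s + bil v w, w)\<bar> \<partial>lborel) = (\<integral>s. \<bar>h (s, w)\<bar> \<partial>lborel)" for w
    by (rule integral_lborel_translation[of "\<lambda>s. \<bar>h (s, w)\<bar>"]) measurable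
  then show "integrable lborel (\<lambda>w. \<integral>s. norm (case (w, s) of (w, s) \<Rightarrow> h (s + bil v w, w)) \<partial>lborel)"
    using integrable_abs_snd by simp
  show "AE w in lborel. integrable lborel (\<lambda>s. case (w, s) of (w, s) \<Rightarrow> h (s + bil v w, w))"
    using integrable_lborel_translation[OF h_integrable_fst] by simp
qed measurable

lemma U_integrable: "integrable lborel (\<lambda>s. U s v)"
  unfolding U_def using lborel_pair.integrable_snd[OF integrable_shear] by simp

lemma F_integrable: "integrable lborel (\<lambda>w. F w \<sigma>)"
proof (rule Bochner_Integration.integrable_bound)
  show "integrable lborel (\<lambda>w. \<integral>s. \<bar>h (s, w)\<bar> \<partial>lborel)"
    by (rule integrable_abs_snd)
  show "AE w in lborel. norm (F w \<sigma>) \<le> norm (\<integral>s. \<bar>h (s, w)\<bar> \<partial>lborel)"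
    using norm_fourier_le[of "\<lambda>t. h (t, w)" \<sigma> for w] by (auto simp: F_def intro!: AE_I2 order_trans[OF _ abs_ge_self])
qed measurable

text \<open>The Fourier slice identity: for each \<open>w\<close> the shift by
  \<open>bil v w\<close> becomes a phase, so the transform in \<open>s\<close> is an oscillatory
  integral over \<open>w\<close>.\<close>

lemma fourier_U: "fourier (\<lambda>s. U s v) \<sigma> = (\<integral>w. F w \<sigma> * cis (v \<bullet> freq \<sigma> w) \<partial>lborel)"
proof -
  have "fourier (\<lambda>s. U s v) \<sigma> = (\<integral>s. (\<integral>w. h (s + bil v w, w) *\<^sub>R cis (- (s \<bullet> \<sigma>)) \<partial>lborel) \<partial>lborel)"
    unfolding fourier_def U_def using h_integrable_snd by simp
  also have "\<dots> = (\<integral>w. (\<integral>s. h (s + bil v w, w) *\<^sub>R cis (- (s \<bullet> \<sigma>)) \<partial>lborel) \<partial>lborel)"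
  proof (rule lborel_pair.Fubini_integral)
    show "integrable (lborel \<Otimes>\<^sub>M lborel) (\<lambda>(w, s). h (s + bil v w, w) *\<^sub>R cis (- (s \<bullet> \<sigma>)))"
      by (rule Bochner_Integration.integrable_bound[OF integrable_shear[of v]]) auto
  qed
  also have "\<dots> = (\<integral>w. F w \<sigma> * cis (v \<bullet> freq \<sigma> w) \<partial>lborel)"
  proof (intro Bochner_Integration.integral_cong refl)
    fix w
    have "(\<integral>s. h (s + bil v w, w) *\<^sub>R cis (- (s \<bullet> \<sigma>)) \<partial>lborel) = fourier (\<lambda>s. h (s + bil v w, w)) \<sigma>"
      by (simp add: fourier_def)
    also have "\<dots> = cis (bil v w \<bullet> \<sigma>) * F w \<sigma>"
      unfolding F_def by (rule fourier_translation) measurable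
    finally show "(\<integral>s. h (s + bil v w, w) *\<^sub>R cis (- (s \<bullet> \<sigma>)) \<partial>lborel) = F w \<sigma> * cis (v \<bullet> freq \<sigma> w)"
      by (simp add: inner_bil mult.commute)
  qed
  finally show ?thesis .
qed

text \<open>Plancherel in \<open>s\<close> for each \<open>v\<close>, which gives the factor
  \<open>(2 * pi)\<^sup>2\<close>, followed by \<open>gaussian_oscillatory_bound\<close> in
  \<open>v\<close> for each frequency \<sigma>.\<close>

lemma energy_bound:
  "ennreal ((2 * pi)\<^sup>2) * (\<integral>\<^sup>+v. (\<integral>\<^sup>+s. ennreal (exp (- (norm v)\<^sup>2 / 2) * (U s v)\<^sup>2) \<partial>lborel) \<partial>lborel)
    \<le> (\<integral>\<^sup>+\<sigma>. ennreal ((2 * pi) ^ 4 / norm \<sigma> ^ 4) * (\<integral>\<^sup>+w. ennreal ((norm (F w \<sigma>))\<^sup>2) \<partial>lborel) \<partial>lborel)"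
proof -
  have sqrt4: "sqrt (2 * pi) ^ 4 = (2 * pi)\<^sup>2"
    using power_mult[of "sqrt (2 * pi)" 2 2] by simp
  have inner: "(\<integral>\<^sup>+s. ennreal (exp (- (norm v)\<^sup>2 / 2) * (U s v)\<^sup>2) \<partial>lborel)
      = ennreal (exp (- (norm v)\<^sup>2 / 2)) * (\<integral>\<^sup>+s. ennreal ((U s v)\<^sup>2) \<partial>lborel)" for v
    by (subst nn_integral_cmult[symmetric]) (auto simp: ennreal_mult)
  have "ennreal ((2 * pi)\<^sup>2) * (\<integral>\<^sup>+v. (\<integral>\<^sup>+s. ennreal (exp (- (norm v)\<^sup>2 / 2) * (U s v)\<^sup>2) \<partial>lborel) \<partial>lborel)
      = (\<integral>\<^sup>+v. ennreal ((2 * pi)\<^sup>2) * (ennreal (exp (- (norm v)\<^sup>2 / 2)) * (\<integral>\<^sup>+s. ennreal ((U s v)\<^sup>2) \<partial>lborel)) \<partial>lborel)"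
    unfolding inner by (rule nn_integral_cmult[symmetric]) measurable
  also have "\<dots> = (\<integral>\<^sup>+v. ennreal (exp (- (norm v)\<^sup>2 / 2)) * (ennreal ((2 * pi)\<^sup>2) * (\<integral>\<^sup>+s. ennreal ((U s v)\<^sup>2) \<partial>lborel)) \<partial>lborel)"
    by (simp only: mult.left_commute)
  also have "\<dots> = (\<integral>\<^sup>+v. ennreal (exp (- (norm v)\<^sup>2 / 2)) * (\<integral>\<^sup>+\<sigma>. ennreal ((norm (fourier (\<lambda>s. U s v) \<sigma>))\<^sup>2) \<partial>lborel) \<partial>lborel)"
    by (subst plancherel[OF U_integrable U_bound]) simp
  also have "\<dots> = (\<integral>\<^sup>+v. (\<integral>\<^sup>+\<sigma>. ennreal (exp (- (norm v)\<^sup>2 / 2) * (norm (\<integral>w. F w \<sigma> * cis (v \<bullet> freq \<sigma> w) \<partial>lborel))\<^sup>2) \<partial>lborel) \<partial>lborel)"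
    unfolding fourier_U
    by (subst nn_integral_cmult[symmetric]) (auto simp: ennreal_mult)
  also have "\<dots> = (\<integral>\<^sup>+\<sigma>. (\<integral>\<^sup>+v. ennreal (exp (- (norm v)\<^sup>2 / 2) * (norm (\<integral>w. F w \<sigma> * cis (v \<bullet> freq \<sigma> w) \<partial>lborel))\<^sup>2) \<partial>lborel) \<partial>lborel)"
    by (rule lborel_pair.Fubini') measurable
  also have "\<dots> \<le> (\<integral>\<^sup>+\<sigma>. ennreal ((2 * pi) ^ 4 / norm \<sigma> ^ 4) * (\<integral>\<^sup>+w. ennreal ((norm (F w \<sigma>))\<^sup>2) \<partial>lborel) \<partial>lborel)"
  proof (rule nn_integral_mono_AE)
    \<comment> \<open>Here \<open>L\<close> is \<open>freq \<sigma>\<close> and \<open>r\<close> is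
      \<open>norm \<sigma>\<close>; both real dimensions are 4. At \<sigma> = 0 division by zero
      turns the right side into 0, so this null set is excluded.\<close>
    show "AE \<sigma> in lborel. (\<integral>\<^sup>+v. ennreal (exp (- (norm v)\<^sup>2 / 2) * (norm (\<integral>w. F w \<sigma> * cis (v \<bullet> freq \<sigma> w) \<partial>lborel))\<^sup>2) \<partial>lborel)
        \<le> ennreal ((2 * pi) ^ 4 / norm \<sigma> ^ 4) * (\<integral>\<^sup>+w. ennreal ((norm (F w \<sigma>))\<^sup>2) \<partial>lborel)"
      using AE_lborel_singleton[of "0::complex"]
    proof eventually_elim
      case (elim \<sigma>)
      have "sqrt (2 * pi) ^ DIM(complex \<times> complex) * (sqrt (2 * pi) / norm \<sigma>) ^ DIM(complex \<times> complex) = (2 * pi) ^ 4 / norm \<sigma> ^ 4"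
        by (simp add: power_divide sqrt4)
      then show ?case
        using gaussian_oscillatory_bound[OF F_integrable linear_freq norm_freq, of \<sigma>] elim by simp
    qed
  qed
  finally show ?thesis .
qed

end

section \<open>Second differences in the first coordinate\<close>

lemma norm_two_cos_le: "\<bar>2 * cos x - 2\<bar> \<le> x\<^sup>2" for x :: real
proof -
  have "(sin (x / 2))\<^sup>2 \<le> (x / 2)\<^sup>2"
    by (rule abs_le_square_iff[THEN iffD1, OF abs_sin_x_le_abs_x])
  moreover have "cos x = 1 - 2 * (sin (x / 2))\<^sup>2"
    using cos_double_sin[of "x / 2"] by simp
  ultimately show ?thesis by (simp add: power_divide)
qed

text \<open>The step is real and moves only the first coordinate. A shift of \<open>t\<close> in the
  kernel is a shift of \<open>s\<close> in its transform, so this operation commutes with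
  \<open>U\<close>.\<close>

definition second_difference :: "real \<Rightarrow> (complex \<times> complex \<times> complex \<Rightarrow> real) \<Rightarrow> complex \<times> complex \<times> complex \<Rightarrow> real" where
  "second_difference \<epsilon> g p = g (fst p + of_real \<epsilon>, snd p) - 2 * g p + g (fst p - of_real \<epsilon>, snd p)"

context bounded_kernel
begin

lemma bounded_kernel_second_difference: "bounded_kernel (second_difference \<epsilon> h) (4 * C) (R + \<bar>\<epsilon>\<bar>)"
proof
  show "second_difference \<epsilon> h \<in> borel_measurable borel"
    unfolding second_difference_def by measurable
  show "\<bar>second_difference \<epsilon> h p\<bar> \<le> 4 * C" for p
    using h_bound[of p] h_bound[of "(fst p + of_real \<epsilon>, snd p)"] h_bound[of "(fst p - of_real \<epsilon>, snd p)"]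
    unfolding second_difference_def by linarith
  fix t :: complex and w :: "complex \<times> complex"
  assume *: "R + \<bar>\<epsilon>\<bar> < norm t \<or> R + \<bar>\<epsilon>\<bar> < norm w"
  have "norm t \<le> norm (t + of_real \<epsilon>) + \<bar>\<epsilon>\<bar>" "norm t \<le> norm (t - of_real \<epsilon>) + \<bar>\<epsilon>\<bar>"
    using norm_triangle_ineq4[of "t + of_real \<epsilon>" "of_real \<epsilon>"] norm_triangle_ineq[of "t - of_real \<epsilon>" "of_real \<epsilon>"] by simp_all
  with * have "R < norm (t + of_real \<epsilon>) \<or> R < norm w" "R < norm (t - of_real \<epsilon>) \<or> R < norm w" "R < norm t \<or> R < norm w"
    by linarith+
  note this[THEN h_supp]
  then show "second_difference \<epsilon> h (t, w) = 0"
    by (simp add: second_difference_def)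
qed

text \<open>On the Fourier side the second difference is multiplication by
  \<open>2 * cos (\<epsilon> * Re \<sigma>) - 2\<close>, which is quadratic in the
  frequency.\<close>

lemma F_second_difference:
  "norm (bounded_kernel.F (second_difference \<epsilon> h) w \<sigma>) \<le> \<epsilon>\<^sup>2 * (norm \<sigma>)\<^sup>2 * norm (F w \<sigma>)"
proof -
  interpret D: bounded_kernel "second_difference \<epsilon> h" "4 * C" "R + \<bar>\<epsilon>\<bar>"
    by (rule bounded_kernel_second_difference)
  let ?f = "\<lambda>t. h (t, w)"
  have i: "integrable lborel (\<lambda>t. ?f (t + c) *\<^sub>R cis (- (t \<bullet> \<sigma>)))" for c
    by (rule integrable_scaleR_cis[OF integrable_lborel_translation[OF h_integrable_fst]]) measurable
  \<comment> \<open>The unshifted term is written as a shift by 0 and the last one as a shift by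
    \<open>of_real (- \<epsilon>)\<close>, so that \<open>fourier_translation\<close> covers all
    three.\<close>
  have "D.F w \<sigma> = (\<integral>t. (?f (t + of_real \<epsilon>) *\<^sub>R cis (- (t \<bullet> \<sigma>)) - 2 *\<^sub>R (?f (t + 0) *\<^sub>R cis (- (t \<bullet> \<sigma>)))) + ?f (t + of_real (- \<epsilon>)) *\<^sub>R cis (- (t \<bullet> \<sigma>)) \<partial>lborel)"
    unfolding D.F_def fourier_def second_difference_def by (intro Bochner_Integration.integral_cong) (auto simp: algebra_simps)
  also have "\<dots> = (fourier (\<lambda>t. ?f (t + of_real \<epsilon>)) \<sigma> - 2 *\<^sub>R fourier (\<lambda>t. ?f (t + 0)) \<sigma>) + fourier (\<lambda>t. ?f (t + of_real (- \<epsilon>))) \<sigma>"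
    unfolding fourier_def
    by (simp only: Bochner_Integration.integral_add Bochner_Integration.integral_diff integral_scaleR_right i integrable_scaleR_right Bochner_Integration.integrable_diff)
  also have "\<dots> = (cis (of_real \<epsilon> \<bullet> \<sigma>) - 2 *\<^sub>R cis (0 \<bullet> \<sigma>) + cis (of_real (- \<epsilon>) \<bullet> \<sigma>)) * F w \<sigma>"
    by (subst (1 2 3) fourier_translation) (auto simp: F_def algebra_simps)
  also have "cis (of_real \<epsilon> \<bullet> \<sigma>) - 2 *\<^sub>R cis (0 \<bullet> \<sigma>) + cis (of_real (- \<epsilon>) \<bullet> \<sigma>) = of_real (2 * cos (\<epsilon> * Re \<sigma>) - 2)"
    by (simp add: complex_eq_iff inner_complex_def)
  finally have "norm (D.F w \<sigma>) = \<bar>2 * cos (\<epsilon> * Re \<sigma>) - 2\<bar> * norm (F w \<sigma>)"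
    by (simp only: norm_mult norm_of_real)
  also have "\<dots> \<le> (\<epsilon> * Re \<sigma>)\<^sup>2 * norm (F w \<sigma>)"
    by (intro mult_right_mono norm_two_cos_le) simp
  also have "\<dots> \<le> (\<epsilon>\<^sup>2 * (norm \<sigma>)\<^sup>2) * norm (F w \<sigma>)"
    using abs_Re_le_cmod[of \<sigma>] by (intro mult_right_mono) (auto simp: power_mult_distrib abs_le_square_iff[symmetric] intro!: mult_left_mono)
  finally show ?thesis .
qed

text \<open>The squared multiplier is at most \<epsilon>^4 times the fourth power of
  \<open>norm \<sigma>\<close>, which exactly cancels the decay in \<open>energy_bound\<close>.
  Plancherel in \<open>t\<close> then leads back to \<open>h\<close> itself, so the constant
  involves the bounds of \<open>h\<close> and not those of its second difference.\<close>

lemma second_difference_energy: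
  "(\<integral>\<^sup>+v. (\<integral>\<^sup>+s. ennreal (exp (- (norm v)\<^sup>2 / 2) * (bounded_kernel.U (second_difference \<epsilon> h) s v)\<^sup>2) \<partial>lborel) \<partial>lborel)
    \<le> ennreal ((2 * pi) ^ 4 * \<epsilon> ^ 4 * (C\<^sup>2 * measure lborel (cball (0::complex) R) * measure lborel (cball (0::complex \<times> complex) R)))"
proof -
  interpret D: bounded_kernel "second_difference \<epsilon> h" "4 * C" "R + \<bar>\<epsilon>\<bar>"
    by (rule bounded_kernel_second_difference)
  have "ennreal ((2 * pi)\<^sup>2) * (\<integral>\<^sup>+v. (\<integral>\<^sup>+s. ennreal (exp (- (norm v)\<^sup>2 / 2) * (D.U s v)\<^sup>2) \<partial>lborel) \<partial>lborel)
    \<le> (\<integral>\<^sup>+\<sigma>. ennreal ((2 * pi) ^ 4 / norm \<sigma> ^ 4) * (\<integral>\<^sup>+w. ennreal ((norm (D.F w \<sigma>))\<^sup>2) \<partial>lborel) \<partial>lborel)"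
    by (rule D.energy_bound)
  also have "\<dots> \<le> (\<integral>\<^sup>+\<sigma>. (\<integral>\<^sup>+w. ennreal ((2 * pi) ^ 4 * \<epsilon> ^ 4) * ennreal ((norm (F w \<sigma>))\<^sup>2) \<partial>lborel) \<partial>lborel)"
  proof (subst nn_integral_cmult[symmetric], measurable, intro nn_integral_mono)
    fix \<sigma> w
    have "(2 * pi) ^ 4 / norm \<sigma> ^ 4 * (norm (D.F w \<sigma>))\<^sup>2 \<le> (2 * pi) ^ 4 / norm \<sigma> ^ 4 * (\<epsilon>\<^sup>2 * (norm \<sigma>)\<^sup>2 * norm (F w \<sigma>))\<^sup>2"
      by (intro mult_left_mono power_mono F_second_difference) auto
    \<comment> \<open>At \<sigma> = 0 the left side is 0 by division by zero.\<close>
    also have "\<dots> \<le> (2 * pi) ^ 4 * \<epsilon> ^ 4 * (norm (F w \<sigma>))\<^sup>2"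
      by (cases "\<sigma> = 0") (auto simp: power_mult_distrib field_simps simp flip: power_mult)
    finally show "ennreal ((2 * pi) ^ 4 / norm \<sigma> ^ 4) * ennreal ((norm (D.F w \<sigma>))\<^sup>2) \<le> ennreal ((2 * pi) ^ 4 * \<epsilon> ^ 4) * ennreal ((norm (F w \<sigma>))\<^sup>2)"
      by (subst (1 2) ennreal_mult[symmetric]) (auto intro: ennreal_leI)
  qed
  also have "\<dots> = (\<integral>\<^sup>+w. (\<integral>\<^sup>+\<sigma>. ennreal ((2 * pi) ^ 4 * \<epsilon> ^ 4) * ennreal ((norm (F w \<sigma>))\<^sup>2) \<partial>lborel) \<partial>lborel)"
    by (rule lborel_pair.Fubini') measurable
  \<comment> \<open>The factor \<open>(2 * pi)\<^sup>2\<close> from this second use of Plancherel is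
    cancelled at the end against the one on the left.\<close>
  also have "\<dots> = (\<integral>\<^sup>+w. ennreal ((2 * pi) ^ 4 * \<epsilon> ^ 4) * (ennreal ((2 * pi)\<^sup>2) * (\<integral>\<^sup>+t. ennreal ((h (t, w))\<^sup>2) \<partial>lborel)) \<partial>lborel)"
    unfolding F_def using plancherel[OF h_integrable_fst h_bound] by (subst nn_integral_cmult) auto
  also have "\<dots> \<le> (\<integral>\<^sup>+w. ennreal ((2 * pi) ^ 4 * \<epsilon> ^ 4) * (ennreal ((2 * pi)\<^sup>2) * (\<integral>\<^sup>+t. ennreal (C\<^sup>2) * indicator (cball 0 R) t * indicator (cball 0 R) w \<partial>(lborel :: complex measure))) \<partial>(lborel :: (complex \<times> complex) measure))"
  proof -
    have "ennreal ((h (t, w))\<^sup>2) \<le> ennreal (C\<^sup>2) * indicator (cball 0 R) t * indicator (cball 0 R) w" for t w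
    proof -
      have "(h (t, w))\<^sup>2 \<le> C\<^sup>2" using h_bound[of "(t, w)"] C_nonneg by (simp add: abs_le_square_iff[symmetric])
      then show ?thesis
        using h_supp[of t w] by (auto simp: indicator_def not_le intro: ennreal_leI)
    qed
    then show ?thesis
      by (intro nn_integral_mono mult_left_mono) auto
  qed
  also have "\<dots> = (\<integral>\<^sup>+w. (ennreal ((2 * pi) ^ 4 * \<epsilon> ^ 4) * (ennreal ((2 * pi)\<^sup>2) * (ennreal (C\<^sup>2) * emeasure lborel (cball (0::complex) R)))) * indicator (cball 0 R) w \<partial>(lborel :: (complex \<times> complex) measure))"
  proof -
    have "(\<integral>\<^sup>+t. ennreal (C\<^sup>2) * indicator (cball 0 R) t * indicator (cball 0 R) w \<partial>(lborel :: complex measure))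
        = ennreal (C\<^sup>2) * emeasure lborel (cball (0::complex) R) * indicator (cball 0 R) w" for w :: "complex \<times> complex"
    proof -
      have "(\<integral>\<^sup>+t. ennreal (C\<^sup>2) * indicator (cball 0 R) t * indicator (cball 0 R) w \<partial>(lborel :: complex measure))
          = (\<integral>\<^sup>+t. ennreal (C\<^sup>2) * indicator (cball 0 R) t \<partial>(lborel :: complex measure)) * indicator (cball 0 R) w"
        by (rule nn_integral_multc, intro borel_measurable_times_ennreal borel_measurable_const borel_measurable_indicator) simp
      also have "(\<integral>\<^sup>+t. ennreal (C\<^sup>2) * indicator (cball 0 R) t \<partial>(lborel :: complex measure)) = ennreal (C\<^sup>2) * emeasure lborel (cball (0::complex) R)"
        by (rule nn_integral_cmult_indicator) simp
      finally show ?thesis .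
    qed
    then show ?thesis by (simp only: mult.assoc)
  qed
  also have "\<dots> = (ennreal ((2 * pi) ^ 4 * \<epsilon> ^ 4) * (ennreal ((2 * pi)\<^sup>2) * (ennreal (C\<^sup>2) * emeasure lborel (cball (0::complex) R)))) * emeasure lborel (cball (0::complex \<times> complex) R)"
    by (rule nn_integral_cmult_indicator) simp
  also have "\<dots> = ennreal ((2 * pi)\<^sup>2) * ennreal ((2 * pi) ^ 4 * \<epsilon> ^ 4 * (C\<^sup>2 * measure lborel (cball (0::complex) R) * measure lborel (cball (0::complex \<times> complex) R)))"
  proof -
    have "emeasure lborel (cball (0::complex) R) = ennreal (measure lborel (cball (0::complex) R))"
      "emeasure lborel (cball (0::complex \<times> complex) R) = ennreal (measure lborel (cball (0::complex \<times> complex) R))"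
      using emeasure_lborel_cball_finite by (auto intro!: emeasure_eq_ennreal_measure simp: less_top[symmetric])
    then show ?thesis
      by (simp only: ennreal_mult[symmetric] measure_nonneg zero_le_power2 mult_nonneg_nonneg zero_le_power pi_ge_zero zero_le_numeral zero_le_even_power even_numeral)
         (simp only: mult_ac)
  qed
  finally show ?thesis
    by (rule ennreal_mult_le_mult_iff[THEN iffD1, rotated 2]) auto
qed

end

section \<open>The contribution of one message\<close>

lemma (in bounded_kernel) U_second_difference:
  "bounded_kernel.U (second_difference \<epsilon> h) s v = U (s + of_real \<epsilon>) v - 2 * U s v + U (s - of_real \<epsilon>) v"
proof -
  interpret D: bounded_kernel "second_difference \<epsilon> h" "4 * C" "R + \<bar>\<epsilon>\<bar>"
    by (rule bounded_kernel_second_difference)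
  have "D.U s v = (\<integral>w. h (s + of_real \<epsilon> + bil v w, w) - 2 * h (s + bil v w, w) + h (s - of_real \<epsilon> + bil v w, w) \<partial>lborel)"
    unfolding D.U_def second_difference_def by (intro Bochner_Integration.integral_cong) (auto simp: algebra_simps)
  also have "\<dots> = U (s + of_real \<epsilon>) v - 2 * U s v + U (s - of_real \<epsilon>) v"
    unfolding U_def using h_integrable_snd
    by (subst Bochner_Integration.integral_add Bochner_Integration.integral_diff
        | auto intro!: Bochner_Integration.integrable_diff integrable_mult_right)+
  finally show ?thesis .
qed

lemma ennreal_le_sqrt: "y\<^sup>2 \<le> ennreal q \<Longrightarrow> y \<le> ennreal (sqrt q)"
proof (cases y)
  case (real r)
  assume "y\<^sup>2 \<le> ennreal q"
  then have *: "ennreal (r\<^sup>2) \<le> ennreal q" using real by (simp add: ennreal_power)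
  show ?thesis
  proof (cases "r = 0")
    case False
    then have "r\<^sup>2 \<le> q" using * real(1)
      by (metis ennreal_le_iff2 less_eq_real_def not_le zero_less_power2)
    then show ?thesis using real by (simp add: real_le_rsqrt ennreal_leI)
  qed (use real in simp)
qed (simp add: top_unique power2_eq_square ennreal_top_mult)

lemma emeasure_lborel_cball_eq: "emeasure lborel (cball c r) = ennreal (measure lborel (cball c r))"
  for c :: "'a::euclidean_space"
  using emeasure_lborel_cball_finite[of c r] by (intro emeasure_eq_ennreal_measure) auto

lemma emeasure_lborel_cball_Times:
  fixes c :: "'a::euclidean_space" and d :: "'b::euclidean_space"
  shows "emeasure lborel (cball c r \<times> cball d s) = ennreal (measure lborel (cball c r) * measure lborel (cball d s))"
proof -
  have "emeasure lborel (cball c r \<times> cball d s) = emeasure lborel (cball c r) * emeasure lborel (cball d s)"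
    by (subst lborel_prod[symmetric], rule lborel.emeasure_pair_measure_Times) auto
  then show ?thesis
    unfolding emeasure_lborel_cball_eq by (simp add: ennreal_mult)
qed

text \<open>The Gaussian of \<open>energy_bound\<close>: a point is \<open>p = (s, v)\<close>, and
  only \<open>v\<close> is weighted.\<close>

definition weight :: "complex \<times> complex \<times> complex \<Rightarrow> real" where
  "weight p = exp (- (norm (snd p))\<^sup>2 / 2)"

lemma measurable_weight [measurable]: "weight \<in> borel_measurable borel"
  unfolding weight_def by measurable

lemma weight_pos: "weight p > 0" and weight_le_1: "weight p \<le> 1"
  by (simp_all add: weight_def)

text \<open>\<open>f\<close> stands for the encoder and \<open>g\<close> for the decoder at one
  message and one value of the randomness.\<close>

locale kernel_pair =
  f: bounded_kernel f C R + g: bounded_kernel g C R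
  for f g :: "complex \<times> complex \<times> complex \<Rightarrow> real" and C R :: real +
  assumes f_nonneg: "\<And>p. f p \<ge> 0" and g_nonneg: "\<And>p. g p \<ge> 0"
begin

definition u :: "complex \<times> complex \<times> complex \<Rightarrow> real" where
  "u p = g.U (fst p) (snd p)"

text \<open>The weighted mass that \<open>f\<close> and \<open>g\<close> put on pairs with t - s - v
  \<cdot> w = z; \<open>I_eq\<close> gives that form. The offset is real, in line with
  \<open>second_difference\<close>.\<close>

definition I :: "real \<Rightarrow> ennreal" where
  "I z = (\<integral>\<^sup>+p. ennreal (weight p * f p * u (p + (of_real z, 0))) \<partial>lborel)"

definition A :: "(complex \<times> complex \<times> complex) set" where
  "A = {p. f p \<noteq> 0 \<and> u p = 0}"

definition bad :: "real \<Rightarrow> (complex \<times> complex \<times> complex) set" where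
  "bad \<epsilon> = {p \<in> A. p + (of_real \<epsilon>, 0) \<notin> A \<or> p + (of_real (- \<epsilon>), 0) \<notin> A}"

definition M :: real where
  "M = measure lborel (cball (0::complex) R) * measure lborel (cball (0::complex \<times> complex) R)"

text \<open>The outer \<open>C\<^sup>2\<close> bounds the square of \<open>f\<close>; the rest is
  the constant of \<open>second_difference_energy\<close> without \<epsilon>^4.\<close>

definition K :: real where
  "K = C\<^sup>2 * ((2 * pi) ^ 4 * (C\<^sup>2 * M))"

lemma u_nonneg: "u p \<ge> 0"
  unfolding u_def g.U_def by (rule Bochner_Integration.integral_nonneg) (rule g_nonneg)

lemma measurable_u [measurable]: "u \<in> borel_measurable borel"
  unfolding u_def by measurable

lemma A_sets [measurable]: "A \<in> sets borel"
  unfolding A_def by measurable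

lemma bad_sets [measurable]: "bad \<epsilon> \<in> sets borel"
proof -
  have "(\<lambda>p :: complex \<times> complex \<times> complex. p + c) -` A \<inter> space borel \<in> sets borel" for c
    by (rule measurable_sets[OF _ A_sets]) measurable
  then have "A \<inter> (- ((\<lambda>p. p + (of_real \<epsilon>, 0)) -` A) \<union> - ((\<lambda>p. p + (of_real (- \<epsilon>), 0)) -` A)) \<in> sets borel"
    by (intro sets.Int sets.Un borel_comp A_sets) simp_all
  moreover have "bad \<epsilon> = A \<inter> (- ((\<lambda>p. p + (of_real \<epsilon>, 0)) -` A) \<union> - ((\<lambda>p. p + (of_real (- \<epsilon>), 0)) -` A))"
    by (auto simp: bad_def)
  ultimately show ?thesis by simp
qed

lemma emeasure_box: "emeasure lborel (cball (0::complex) R \<times> cball (0::complex \<times> complex) R) = ennreal M"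
  unfolding M_def by (rule emeasure_lborel_cball_Times)

lemma A_subset: "A \<subseteq> cball 0 R \<times> cball 0 R"
  using f.h_supp by (fastforce simp: A_def not_le[symmetric])

lemma emeasure_A: "emeasure lborel A \<le> ennreal M"
  unfolding emeasure_box[symmetric] by (rule emeasure_mono[OF A_subset]) (simp add: borel_Times)

lemma emeasure_bad: "emeasure lborel (bad \<epsilon>) \<le> ennreal M"
  by (rule order_trans[OF emeasure_mono emeasure_A]) (auto simp: bad_def)

lemma M_nonneg: "M \<ge> 0" by (simp add: M_def)

lemma K_nonneg: "K \<ge> 0" by (simp add: K_def M_nonneg)

lemma measure_bad_le: "measure lborel (bad \<epsilon>) \<le> M"
  unfolding measure_def using emeasure_bad[of \<epsilon>] M_nonneg by (metis enn2real_leI)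

lemma emeasure_bad_eq: "emeasure lborel (bad \<epsilon>) = ennreal (measure lborel (bad \<epsilon>))"
  using emeasure_bad[of \<epsilon>] by (intro emeasure_eq_ennreal_measure) (auto simp: top_unique)

text \<open>A bad point lies in \<open>A\<close> but has a translate outside \<open>A\<close>, so
  the measure is at most the sum of the L1 distances between the indicator of \<open>A\<close> and
  its two translates. There is no rate; the factor \<epsilon>^2 comes from the energy bound
  instead.\<close>

lemma measure_bad_tendsto:
  assumes X: "X \<longlonglongrightarrow> 0"
  shows "(\<lambda>n. measure lborel (bad (X n))) \<longlonglongrightarrow> 0"
proof -
  have int: "integrable lborel (indicator A :: _ \<Rightarrow> real)"
    using emeasure_A by (intro integrable_real_indicator) (auto simp: le_less_trans[OF emeasure_A])
  define d where "d c = (\<integral>\<^sup>+p. ennreal \<bar>indicator A (p + c) - indicator A p\<bar> \<partial>lborel)" for c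
  have d_lim: "(\<lambda>n. d (of_real (Y n), 0)) \<longlonglongrightarrow> 0" if "Y \<longlonglongrightarrow> 0" for Y
  proof -
    have "(\<lambda>n. (complex_of_real (Y n), 0 :: complex \<times> complex)) \<longlonglongrightarrow> (of_real 0, 0)"
      using that by (intro tendsto_Pair tendsto_of_real tendsto_const)
    then show ?thesis
      unfolding d_def by (intro translation_continuous_L1[OF int]) (simp add: zero_prod_def)
  qed
  have "(\<lambda>n. d (of_real (X n), 0) + d (of_real (- X n), 0)) \<longlonglongrightarrow> 0 + 0"
    using X by (intro tendsto_add d_lim) (auto intro: tendsto_minus[where a="0::real", simplified])
  then have lim: "(\<lambda>n. d (of_real (X n), 0) + d (of_real (- X n), 0)) \<longlonglongrightarrow> 0" by simp
  have le: "ennreal (measure lborel (bad (X n))) \<le> d (of_real (X n), 0) + d (of_real (- X n), 0)" for n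
  proof -
    have "emeasure lborel (bad (X n)) = (\<integral>\<^sup>+p. indicator (bad (X n)) p \<partial>lborel)"
      by simp
    also have "\<dots> \<le> (\<integral>\<^sup>+p. ennreal \<bar>indicator A (p + (of_real (X n), 0)) - indicator A p\<bar> + ennreal \<bar>indicator A (p + (of_real (- X n), 0)) - indicator A p\<bar> \<partial>lborel)"
      by (intro nn_integral_mono) (auto simp: bad_def indicator_def)
    also have "\<dots> = d (of_real (X n), 0) + d (of_real (- X n), 0)"
      unfolding d_def by (rule nn_integral_add) measurable
    finally show ?thesis by (simp only: emeasure_bad_eq)
  qed
  have "(\<lambda>n. ennreal (measure lborel (bad (X n)))) \<longlonglongrightarrow> ennreal 0"
    using tendsto_sandwich[OF _ always_eventually[OF allI[OF le]] tendsto_const lim] by simp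
  then show ?thesis by (subst (asm) tendsto_ennreal_iff) auto
qed

text \<open>The second difference of \<open>u\<close> vanishes at \<open>p\<close> when \<open>p\<close> and both translates lie in the zero
  set, so only \<open>bad \<epsilon>\<close> contributes.\<close>

lemma I_sum_le:
  assumes "I 0 = 0"
  shows "(I \<epsilon> + I (- \<epsilon>))\<^sup>2 \<le> ennreal (\<epsilon> ^ 4 * (K * measure lborel (bad \<epsilon>)))"
proof -
  let ?S = "second_difference \<epsilon> g"
  interpret D: bounded_kernel ?S "4 * C" "R + \<bar>\<epsilon>\<bar>"
    by (rule g.bounded_kernel_second_difference)
  define D where "D p = D.U (fst p) (snd p)" for p
  have [measurable]: "D \<in> borel_measurable borel" unfolding D_def by measurable
  have D_eq: "D p = u (p + (of_real \<epsilon>, 0)) - 2 * u p + u (p + (of_real (- \<epsilon>), 0))" for p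
    unfolding D_def u_def g.U_second_difference by simp
  have "AE p in lborel. ennreal (weight p * f p * u (p + (of_real 0, 0))) = 0"
    using assms unfolding I_def by (subst (asm) nn_integral_0_iff_AE) auto
  \<comment> \<open>The integrand of \<open>I 0\<close> is nonnegative with a strictly positive
    weight, so \<open>f\<close> and \<open>u\<close> have almost disjoint supports.\<close>
  then have zero: "AE p in lborel. f p = 0 \<or> u p = 0"
  proof eventually_elim
    case (elim p)
    then have "weight p * f p * u p \<le> 0" by (simp flip: zero_prod_def add: ennreal_eq_0_iff)
    moreover have "weight p * f p * u p \<ge> 0" using weight_pos[of p] f_nonneg[of p] u_nonneg[of p] by simp
    ultimately have "weight p * f p * u p = 0" by linarith
    then show ?case using weight_pos[of p] by auto
  qed
  have "I \<epsilon> + I (- \<epsilon>) = (\<integral>\<^sup>+p. ennreal (weight p * f p * u (p + (of_real \<epsilon>, 0))) + ennreal (weight p * f p * u (p + (of_real (- \<epsilon>), 0))) \<partial>lborel)"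
    unfolding I_def by (rule nn_integral_add[symmetric]) measurable
  also have "\<dots> \<le> (\<integral>\<^sup>+p. ennreal C * (indicator (bad \<epsilon>) p * ennreal (weight p * \<bar>D p\<bar>)) \<partial>lborel)"
  proof (rule nn_integral_mono_AE, use zero in eventually_elim)
    fix p assume z: "f p = 0 \<or> u p = 0"
    let ?p = "p + (of_real \<epsilon>, 0)" and ?m = "p + (of_real (- \<epsilon>), 0)"
    have nn: "weight p * f p * u ?p \<ge> 0" "weight p * f p * u ?m \<ge> 0" "0 \<le> weight p * \<bar>D p\<bar>"
      using weight_pos[of p] f_nonneg[of p] u_nonneg by simp_all
    show "ennreal (weight p * f p * u ?p) + ennreal (weight p * f p * u ?m) \<le> ennreal C * (indicator (bad \<epsilon>) p * ennreal (weight p * \<bar>D p\<bar>))"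
    proof (cases "f p = 0")
      case False
      then have pA: "p \<in> A" and up: "u p = 0" using z by (auto simp: A_def)
      show ?thesis
      proof (cases "p \<in> bad \<epsilon>")
        case True
        \<comment> \<open>As \<open>u p = 0\<close>, the second difference is the sum of the two
          translated values, both nonnegative, so its absolute value is this sum.\<close>
        have "weight p * f p * u ?p + weight p * f p * u ?m = f p * (weight p * \<bar>D p\<bar>)"
          using u_nonneg[of ?p] u_nonneg[of ?m] by (simp add: D_eq up algebra_simps)
        also have "\<dots> \<le> C * (weight p * \<bar>D p\<bar>)"
          using f.h_bound[of p] f_nonneg[of p] nn(3) by (intro mult_right_mono) auto
        finally show ?thesis
          using True nn f.C_nonneg by (simp flip: ennreal_plus ennreal_mult add: ennreal_leI)
      next
        case False
        then have "u ?p = 0" "u ?m = 0" using pA by (auto simp: bad_def A_def)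
        then show ?thesis by simp
      qed
    qed simp
  qed
  also have "\<dots> = ennreal C * (\<integral>\<^sup>+p. indicator (bad \<epsilon>) p * ennreal (weight p * \<bar>D p\<bar>) \<partial>lborel)"
    by (rule nn_integral_cmult) measurable
  finally have "(I \<epsilon> + I (- \<epsilon>))\<^sup>2 \<le> (ennreal C * (\<integral>\<^sup>+p. indicator (bad \<epsilon>) p * ennreal (weight p * \<bar>D p\<bar>) \<partial>lborel))\<^sup>2"
    by (rule power_mono) simp
  also have "\<dots> = ennreal (C\<^sup>2) * (\<integral>\<^sup>+p. indicator (bad \<epsilon>) p * ennreal (weight p * \<bar>D p\<bar>) \<partial>lborel)\<^sup>2"
    using f.C_nonneg by (simp add: power_mult_distrib ennreal_power)
  \<comment> \<open>Cauchy-Schwarz separates the small measure of the bad set from the energy of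
    order \<epsilon>^4.\<close>
  also have "\<dots> \<le> ennreal (C\<^sup>2) * ((\<integral>\<^sup>+p. (indicator (bad \<epsilon>) p)\<^sup>2 \<partial>lborel) * (\<integral>\<^sup>+p. (ennreal (weight p * \<bar>D p\<bar>))\<^sup>2 \<partial>lborel))"
    by (intro mult_left_mono Cauchy_Schwarz_nn_integral) auto
  also have "(\<integral>\<^sup>+p. (indicator (bad \<epsilon>) p)\<^sup>2 \<partial>lborel) = ennreal (measure lborel (bad \<epsilon>))"
  proof -
    have "(\<integral>\<^sup>+p. (indicator (bad \<epsilon>) p)\<^sup>2 \<partial>lborel) = (\<integral>\<^sup>+p. indicator (bad \<epsilon>) p \<partial>lborel)"
      by (intro nn_integral_cong) (auto simp: indicator_def)
    then show ?thesis by (simp add: emeasure_bad_eq)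
  qed
  \<comment> \<open>The weight is at most 1, so its square may be replaced by the single Gaussian of
    the energy bound.\<close>
  also have "(\<integral>\<^sup>+p. (ennreal (weight p * \<bar>D p\<bar>))\<^sup>2 \<partial>lborel) \<le> (\<integral>\<^sup>+p. ennreal (exp (- (norm (snd p))\<^sup>2 / 2) * (D.U (fst p) (snd p))\<^sup>2) \<partial>lborel)"
  proof (rule nn_integral_mono)
    fix p
    have "(weight p)\<^sup>2 * (D p)\<^sup>2 \<le> weight p * (D p)\<^sup>2"
      using weight_pos[of p] weight_le_1[of p] by (intro mult_right_mono) (auto simp: power2_eq_square)
    then show "(ennreal (weight p * \<bar>D p\<bar>))\<^sup>2 \<le> ennreal (exp (- (norm (snd p))\<^sup>2 / 2) * (D.U (fst p) (snd p))\<^sup>2)"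
      using weight_pos[of p] by (simp add: ennreal_power power_mult_distrib D_def weight_def ennreal_leI)
  qed
  also have "\<dots> = (\<integral>\<^sup>+v. (\<integral>\<^sup>+s. ennreal (exp (- (norm v)\<^sup>2 / 2) * (D.U s v)\<^sup>2) \<partial>lborel) \<partial>lborel)"
    by (subst lborel_prod[symmetric], subst lborel_pair.nn_integral_snd[symmetric]) (auto simp: lborel_prod)
  also have "\<dots> \<le> ennreal ((2 * pi) ^ 4 * \<epsilon> ^ 4 * (C\<^sup>2 * measure lborel (cball (0::complex) R) * measure lborel (cball (0::complex \<times> complex) R)))"
    by (rule g.second_difference_energy)
  also have "ennreal (C\<^sup>2) * (ennreal (measure lborel (bad \<epsilon>)) * ennreal ((2 * pi) ^ 4 * \<epsilon> ^ 4 * (C\<^sup>2 * measure lborel (cball (0::complex) R) * measure lborel (cball (0::complex \<times> complex) R))))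
     = ennreal (\<epsilon> ^ 4 * (K * measure lborel (bad \<epsilon>)))"
  proof -
    have "C\<^sup>2 * (measure lborel (bad \<epsilon>) * ((2 * pi) ^ 4 * \<epsilon> ^ 4 * (C\<^sup>2 * measure lborel (cball (0::complex) R) * measure lborel (cball (0::complex \<times> complex) R))))
      = \<epsilon> ^ 4 * (K * measure lborel (bad \<epsilon>))"
      unfolding K_def M_def by (simp only: mult_ac)
    then show ?thesis
      by (simp only: ennreal_mult[symmetric] measure_nonneg zero_le_power2 mult_nonneg_nonneg zero_le_power pi_ge_zero zero_le_numeral zero_le_even_power even_numeral)
  qed
  finally show ?thesis by (simp add: mult_left_mono)
qed

lemma I_quotient_le:
  assumes "I 0 = 0" "\<epsilon> > 0"
  shows "ennreal (1 / \<epsilon>\<^sup>2) * (I \<epsilon> + I (- \<epsilon>)) \<le> ennreal (sqrt (K * measure lborel (bad \<epsilon>)))"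
proof (rule ennreal_le_sqrt)
  have "(ennreal (1 / \<epsilon>\<^sup>2) * (I \<epsilon> + I (- \<epsilon>)))\<^sup>2 \<le> ennreal ((1 / \<epsilon>\<^sup>2)\<^sup>2) * ennreal (\<epsilon> ^ 4 * (K * measure lborel (bad \<epsilon>)))"
    unfolding power_mult_distrib using I_sum_le[OF assms(1)] by (intro mult_mono) (auto simp: ennreal_power)
  also have "\<dots> = ennreal (K * measure lborel (bad \<epsilon>))"
    using assms(2) K_nonneg by (subst ennreal_mult[symmetric]) (auto simp: power_divide field_simps simp flip: power_mult)
  finally show "(ennreal (1 / \<epsilon>\<^sup>2) * (I \<epsilon> + I (- \<epsilon>)))\<^sup>2 \<le> ennreal (K * measure lborel (bad \<epsilon>))" .
qed

text \<open>The bound depends only on \<open>C\<close> and \<open>R\<close>, so it is a common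
  majorant over all values of the randomness.\<close>

lemma I_quotient_bounded:
  assumes "I 0 = 0" "\<epsilon> > 0"
  shows "ennreal (1 / \<epsilon>\<^sup>2) * (I \<epsilon> + I (- \<epsilon>)) \<le> ennreal (sqrt (K * M))"
  by (rule order_trans[OF I_quotient_le[OF assms]])
     (intro ennreal_leI real_sqrt_le_mono mult_left_mono measure_bad_le K_nonneg)

lemma I_quotient_tendsto:
  assumes "I 0 = 0" "\<And>n. X n > 0" "X \<longlonglongrightarrow> 0"
  shows "(\<lambda>n. ennreal (1 / (X n)\<^sup>2) * (I (X n) + I (- X n))) \<longlonglongrightarrow> 0"
proof -
  have "(\<lambda>n. ennreal (sqrt (K * measure lborel (bad (X n))))) \<longlonglongrightarrow> ennreal (sqrt (K * 0))"
    by (intro tendsto_ennrealI tendsto_real_sqrt tendsto_mult_left measure_bad_tendsto assms)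
  then have "(\<lambda>n. ennreal (sqrt (K * measure lborel (bad (X n))))) \<longlonglongrightarrow> 0" by simp
  from tendsto_sandwich[OF _ always_eventually[OF allI[OF I_quotient_le[OF assms(1,2)]]] tendsto_const this]
  show ?thesis by simp
qed

end

section \<open>Averaging over the shared randomness\<close>

text \<open>Radius 4 suffices: if s, z, v, w have norm at most 1, then t = s + z + v \<cdot> w has
  norm at most 1 + 1 + 2, by \<open>norm_bil_le\<close>.\<close>

definition box4 :: "(complex \<times> complex \<times> complex) set" where
  "box4 = cball 0 4 \<times> cball 0 4"

lemma box4_sets [measurable]: "box4 \<in> sets borel"
  unfolding box4_def by (rule borel_Times) auto

text \<open>The factor \<open>1 + (norm p)\<^sup>2\<close> is the squared norm of the vector with
  parameter \<open>p\<close>. Applied to encoder and decoder, it removes both denominators from the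
  transition probability.\<close>

definition cut :: "(complex \<times> complex \<times> complex \<Rightarrow> real) \<Rightarrow> complex \<times> complex \<times> complex \<Rightarrow> real" where
  "cut a p = indicator box4 p * (1 + (norm p)\<^sup>2) * a p"

text \<open>On \<open>box4\<close> both components have norm at most 4, and 33 = 1 + 16 +
  16.\<close>

lemma bounded_kernel_cut:
  assumes [measurable]: "a \<in> borel_measurable borel" and a: "\<And>p. 0 \<le> a p" "\<And>p. a p \<le> 1"
  shows "bounded_kernel (cut a) 33 4"
proof
  show "cut a \<in> borel_measurable borel" unfolding cut_def by measurable
  show "\<bar>cut a p\<bar> \<le> 33" for p
  proof (cases "p \<in> box4")
    case True
    have "(norm p)\<^sup>2 = (norm (fst p))\<^sup>2 + (norm (snd p))\<^sup>2"
      by (cases p) (simp add: norm_Pair)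
    also have "\<dots> \<le> 4\<^sup>2 + 4\<^sup>2"
      using True by (intro add_mono power_mono) (auto simp: box4_def)
    finally have "(1 + (norm p)\<^sup>2) * a p \<le> 33 * 1"
      using a by (intro mult_mono) auto
    then show ?thesis using True a(1)[of p] by (simp add: cut_def)
  qed (simp add: cut_def)
  show "cut a (t, w) = 0" if "4 < norm t \<or> 4 < norm w" for t w
    using that by (auto simp: cut_def box4_def)
qed

lemma kernel_pair_cut:
  assumes "a \<in> borel_measurable borel" "\<And>p. 0 \<le> a p" "\<And>p. a p \<le> 1"
    and "b \<in> borel_measurable borel" "\<And>p. 0 \<le> b p" "\<And>p. b p \<le> 1"
  shows "kernel_pair (cut a) (cut b) 33 4"
  by (intro kernel_pair.intro kernel_pair_axioms.intro bounded_kernel_cut assms)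
     (auto simp: cut_def assms)

text \<open>For \<open>p = (s, v)\<close> this is the pair \<open>(t, w)\<close> with t - s - v
  \<cdot> w = z.\<close>

definition target :: "real \<Rightarrow> complex \<times> complex \<times> complex \<Rightarrow> complex \<times> complex \<Rightarrow> complex \<times> complex \<times> complex" where
  "target z p w = (fst p + of_real z + bil (snd p) w, w)"

lemma measurable_target [measurable (raw)]:
  assumes [measurable]: "f \<in> borel_measurable M" "g \<in> borel_measurable M"
  shows "(\<lambda>x. target z (f x) (g x)) \<in> borel_measurable M"
  unfolding target_def by measurable

text \<open>Opens up \<open>u\<close>, so that \<open>f\<close> and \<open>g\<close> stand under the
  same integrals and the randomness can be averaged at fixed points.\<close>

lemma (in kernel_pair) I_eq:
  "I z = (\<integral>\<^sup>+p. (\<integral>\<^sup>+w. ennreal (weight p * (f p * g (target z p w))) \<partial>lborel) \<partial>lborel)"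
  unfolding I_def
proof (rule nn_integral_cong)
  fix p
  have "(\<integral>\<^sup>+w. ennreal (weight p * (f p * g (target z p w))) \<partial>lborel) = (\<integral>\<^sup>+w. ennreal (weight p * f p) * ennreal (g (target z p w)) \<partial>lborel)"
    using weight_pos[of p] f_nonneg g_nonneg by (simp flip: ennreal_mult add: mult.assoc)
  also have "\<dots> = ennreal (weight p * f p) * (\<integral>\<^sup>+w. ennreal (g (target z p w)) \<partial>lborel)"
    by (rule nn_integral_cmult) measurable
  also have "(\<integral>\<^sup>+w. ennreal (g (target z p w)) \<partial>lborel) = ennreal (u (p + (of_real z, 0)))"
    unfolding u_def g.U_def target_def using g.h_integrable_snd[of "fst p + of_real z" "snd p"]
    by (subst nn_integral_eq_integral) (auto simp: g_nonneg)
  also have "ennreal (weight p * f p) * ennreal (u (p + (of_real z, 0))) = ennreal (weight p * f p * u (p + (of_real z, 0)))"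
    using weight_pos[of p] f_nonneg u_nonneg by (subst ennreal_mult[symmetric]) auto
  finally show "ennreal (weight p * f p * u (p + (of_real z, 0))) = (\<integral>\<^sup>+w. ennreal (weight p * (f p * g (target z p w))) \<partial>lborel)" ..
qed

text \<open>The analytic core, free of quantum notions. Averaged over \<open>l\<close> and divided
  by z^2, the mass at offset \<open>z\<close> stays above a positive constant; the estimates of
  \<open>kernel_pair\<close> force its symmetrisation to 0. Finiteness of \<open>S\<close> gives one
  integrable majorant for the whole sum.\<close>

lemma no_bounded_decomposition:
  fixes a b :: "nat \<Rightarrow> 'l \<Rightarrow> complex \<times> complex \<times> complex \<Rightarrow> real" and L :: "'l measure"
  assumes L: "prob_space L" and S: "finite S"
    and a_meas: "\<And>c. c \<in> S \<Longrightarrow> (\<lambda>(l, p). a c l p) \<in> borel_measurable (L \<Otimes>\<^sub>M borel)"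
    and b_meas: "\<And>c. c \<in> S \<Longrightarrow> (\<lambda>(l, p). b c l p) \<in> borel_measurable (L \<Otimes>\<^sub>M borel)"
    and a: "\<And>c l p. c \<in> S \<Longrightarrow> l \<in> space L \<Longrightarrow> 0 \<le> a c l p \<and> a c l p \<le> 1"
    and b: "\<And>c l p. c \<in> S \<Longrightarrow> l \<in> space L \<Longrightarrow> 0 \<le> b c l p \<and> b c l p \<le> 1"
    and eq: "\<And>p q. (\<integral>l. (\<Sum>c\<in>S. a c l p * b c l q) \<partial>L)
        = (norm (fst q - fst p - bil (snd p) (snd q)))\<^sup>2 / ((1 + (norm p)\<^sup>2) * (1 + (norm q)\<^sup>2))"
  shows False
proof -
  interpret L: prob_space L by fact
  \<comment> \<open>Written out instead of using \<open>kernel_pair.I\<close>, so that measurability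
    in \<open>l\<close> follows from measurability of parametrised integrals; the two agree on
    \<open>space L\<close>.\<close>
  define G where "G c z l = (\<integral>\<^sup>+p. (\<integral>\<^sup>+w. ennreal (weight p * (cut (a c l) p * cut (b c l) (target z p w))) \<partial>lborel) \<partial>lborel)" for c z l
  define J where "J z = (\<integral>\<^sup>+p. (\<integral>\<^sup>+w. ennreal (weight p * (indicator box4 p * indicator box4 (target z p w))) \<partial>lborel) \<partial>lborel)" for z
  have a_meas' [measurable (raw)]: "(\<lambda>x. a c (f x) (g x)) \<in> borel_measurable N"
    if "c \<in> S" "f \<in> measurable N L" "g \<in> borel_measurable N" for c f g N
    using measurable_compose[OF measurable_Pair[OF that(2,3)] a_meas[OF that(1)]] by simp
  have b_meas' [measurable (raw)]: "(\<lambda>x. b c (f x) (g x)) \<in> borel_measurable N"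
    if "c \<in> S" "f \<in> measurable N L" "g \<in> borel_measurable N" for c f g N
    using measurable_compose[OF measurable_Pair[OF that(2,3)] b_meas[OF that(1)]] by simp
  have pair: "kernel_pair (cut (a c l)) (cut (b c l)) 33 4" if "c \<in> S" "l \<in> space L" for c l
    using a[OF that] b[OF that] a_meas'[OF that(1), of "\<lambda>_. l" borel "\<lambda>p. p"] b_meas'[OF that(1), of "\<lambda>_. l" borel "\<lambda>p. p"] that(2)
    by (intro kernel_pair_cut) auto
  have G_I: "G c z l = kernel_pair.I (cut (a c l)) (cut (b c l)) z" if "c \<in> S" "l \<in> space L" for c z l
    unfolding G_def by (rule kernel_pair.I_eq[OF pair[OF that], symmetric])
  have integrand_meas [measurable]: "(\<lambda>x. weight (fst (snd x)) * (cut (a c (fst x)) (fst (snd x)) * cut (b c (fst x)) (target z (fst (snd x)) (snd (snd x)))))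
      \<in> borel_measurable (L \<Otimes>\<^sub>M (lborel \<Otimes>\<^sub>M lborel))" if [simp]: "c \<in> S" for c z
    unfolding cut_def by measurable
  have G_pair: "G c z l = (\<integral>\<^sup>+x. ennreal (weight (fst x) * (cut (a c l) (fst x) * cut (b c l) (target z (fst x) (snd x)))) \<partial>(lborel \<Otimes>\<^sub>M lborel))"
    if c: "c \<in> S" and l: "l \<in> space L" for c z l
  proof -
    have "(\<lambda>x. weight (fst x) * (cut (a c l) (fst x) * cut (b c l) (target z (fst x) (snd x)))) \<in> borel_measurable (lborel \<Otimes>\<^sub>M lborel)"
      using measurable_compose[OF measurable_Pair1'[OF l] integrand_meas[OF c, of z]] by simp
    then show ?thesis
      unfolding G_def by (subst lborel.nn_integral_fst[symmetric]) auto
  qed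
  interpret LP: pair_sigma_finite L "lborel \<Otimes>\<^sub>M lborel :: ((complex \<times> complex \<times> complex) \<times> (complex \<times> complex)) measure"
    by (intro pair_sigma_finite.intro L.sigma_finite_measure_axioms) (simp add: lborel_prod lborel.sigma_finite_measure_axioms)
  have P2: "sigma_finite_measure (lborel \<Otimes>\<^sub>M lborel :: ((complex \<times> complex \<times> complex) \<times> (complex \<times> complex)) measure)"
    by (simp add: lborel_prod lborel.sigma_finite_measure_axioms)
  have G_meas [measurable]: "(\<lambda>l. G c z l) \<in> borel_measurable L" if c: "c \<in> S" for c z
  proof -
    have "(\<lambda>l. \<integral>\<^sup>+x. ennreal (weight (fst x) * (cut (a c l) (fst x) * cut (b c l) (target z (fst x) (snd x)))) \<partial>(lborel \<Otimes>\<^sub>M lborel)) \<in> borel_measurable L"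
      using integrand_meas[OF c, of z] by (intro sigma_finite_measure.borel_measurable_nn_integral[OF P2]) (auto simp: case_prod_unfold)
    then show ?thesis
      by (rule measurable_cong[THEN iffD1, rotated]) (simp add: G_pair[OF c])
  qed
  \<comment> \<open>At fixed \<open>p\<close> and \<open>q\<close> the factors from
    \<open>cut\<close> cancel the denominators of \<open>eq\<close>, and only the squared offset
    remains.\<close>
  have inner: "(\<integral>\<^sup>+l. (\<Sum>c\<in>S. ennreal (weight p * (cut (a c l) p * cut (b c l) q))) \<partial>L)
      = ennreal ((norm (fst q - fst p - bil (snd p) (snd q)))\<^sup>2) * ennreal (weight p * (indicator box4 p * indicator box4 q))" for p q
  proof -
    let ?X = "\<lambda>l. \<Sum>c\<in>S. a c l p * b c l q"
    let ?W = "weight p * (indicator box4 p * indicator box4 q) * ((1 + (norm p)\<^sup>2) * (1 + (norm q)\<^sup>2))"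
    have W: "?W \<ge> 0" using weight_pos[of p] by (simp add: less_imp_le)
    have nn: "?X l \<ge> 0" if "l \<in> space L" for l
      using a b that by (intro sum_nonneg mult_nonneg_nonneg) auto
    have le: "?X l \<le> real (card S)" if "l \<in> space L" for l
    proof -
      have "?X l \<le> (\<Sum>c\<in>S. 1)"
        using a b that by (intro sum_mono mult_le_one) auto
      then show ?thesis by simp
    qed
    have X_int: "integrable L ?X"
    proof (rule L.integrable_const_bound[where B="real (card S)"])
      show "?X \<in> borel_measurable L"
        by (intro borel_measurable_sum borel_measurable_times a_meas' b_meas') auto
    qed (use nn le in auto)
    have "(\<integral>\<^sup>+l. (\<Sum>c\<in>S. ennreal (weight p * (cut (a c l) p * cut (b c l) q))) \<partial>L) = (\<integral>\<^sup>+l. ennreal ?W * ennreal (?X l) \<partial>L)"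
    proof (rule nn_integral_cong)
      fix l assume l: "l \<in> space L"
      have "(\<Sum>c\<in>S. ennreal (weight p * (cut (a c l) p * cut (b c l) q))) = ennreal (\<Sum>c\<in>S. weight p * (cut (a c l) p * cut (b c l) q))"
        using a b l weight_pos[of p] by (intro sum_ennreal) (auto simp: cut_def less_imp_le)
      also have "(\<Sum>c\<in>S. weight p * (cut (a c l) p * cut (b c l) q)) = ?W * ?X l"
        unfolding sum_distrib_left by (intro sum.cong) (auto simp: cut_def)
      also have "ennreal \<dots> = ennreal ?W * ennreal (?X l)"
        using W nn[OF l] by (rule ennreal_mult)
      finally show "(\<Sum>c\<in>S. ennreal (weight p * (cut (a c l) p * cut (b c l) q))) = ennreal ?W * ennreal (?X l)" .
    qed
    also have "\<dots> = ennreal ?W * (\<integral>\<^sup>+l. ennreal (?X l) \<partial>L)"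
      using X_int by (intro nn_integral_cmult) auto
    also have "(\<integral>\<^sup>+l. ennreal (?X l) \<partial>L) = ennreal (\<integral>l. ?X l \<partial>L)"
      using nn by (intro nn_integral_eq_integral X_int AE_I2) auto
    also have "ennreal ?W * ennreal (\<integral>l. ?X l \<partial>L) = ennreal (?W * (\<integral>l. ?X l \<partial>L))"
      unfolding eq using W by (intro ennreal_mult[symmetric]) auto
    also have "?W * (\<integral>l. ?X l \<partial>L) = (norm (fst q - fst p - bil (snd p) (snd q)))\<^sup>2 * (weight p * (indicator box4 p * indicator box4 q))"
    proof -
      have "1 + (norm p)\<^sup>2 \<noteq> 0" "1 + (norm q)\<^sup>2 \<noteq> 0"
        by (metis add.commute add_nonneg_eq_0_iff zero_le_one zero_le_power2 zero_neq_one)+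
      then show ?thesis unfolding eq by simp
    qed
    finally show ?thesis
      using weight_pos[of p] by (simp add: ennreal_mult less_imp_le)
  qed
  have total: "(\<integral>\<^sup>+l. (\<Sum>c\<in>S. G c z l) \<partial>L) = ennreal (z\<^sup>2) * J z" for z
  proof -
    have "(\<integral>\<^sup>+l. (\<Sum>c\<in>S. G c z l) \<partial>L)
      = (\<integral>\<^sup>+l. (\<integral>\<^sup>+x. (\<Sum>c\<in>S. ennreal (weight (fst x) * (cut (a c l) (fst x) * cut (b c l) (target z (fst x) (snd x))))) \<partial>(lborel \<Otimes>\<^sub>M lborel)) \<partial>L)"
    proof (rule nn_integral_cong)
      fix l assume l: "l \<in> space L"
      have "(\<Sum>c\<in>S. G c z l) = (\<Sum>c\<in>S. \<integral>\<^sup>+x. ennreal (weight (fst x) * (cut (a c l) (fst x) * cut (b c l) (target z (fst x) (snd x)))) \<partial>(lborel \<Otimes>\<^sub>M lborel))"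
        using l by (intro sum.cong refl G_pair)
      also have "\<dots> = (\<integral>\<^sup>+x. (\<Sum>c\<in>S. ennreal (weight (fst x) * (cut (a c l) (fst x) * cut (b c l) (target z (fst x) (snd x))))) \<partial>(lborel \<Otimes>\<^sub>M lborel))"
      proof (rule nn_integral_sum[symmetric])
        fix c assume c: "c \<in> S"
        show "(\<lambda>x. ennreal (weight (fst x) * (cut (a c l) (fst x) * cut (b c l) (target z (fst x) (snd x))))) \<in> borel_measurable (lborel \<Otimes>\<^sub>M lborel)"
          using measurable_compose[OF measurable_Pair1'[OF l] integrand_meas[OF c, of z]] by simp
      qed
      finally show "(\<Sum>c\<in>S. G c z l) = (\<integral>\<^sup>+x. (\<Sum>c\<in>S. ennreal (weight (fst x) * (cut (a c l) (fst x) * cut (b c l) (target z (fst x) (snd x))))) \<partial>(lborel \<Otimes>\<^sub>M lborel))" .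
    qed
    also have "\<dots> = (\<integral>\<^sup>+x. (\<integral>\<^sup>+l. (\<Sum>c\<in>S. ennreal (weight (fst x) * (cut (a c l) (fst x) * cut (b c l) (target z (fst x) (snd x))))) \<partial>L) \<partial>(lborel \<Otimes>\<^sub>M lborel))"
      by (rule LP.Fubini'[symmetric]) (auto simp: case_prod_unfold)
    \<comment> \<open>At \<open>target z p w\<close> the offset is exactly \<open>z\<close>, so the
      factor \<open>z\<^sup>2\<close> is constant.\<close>
    also have "\<dots> = (\<integral>\<^sup>+x. ennreal (z\<^sup>2) * ennreal (weight (fst x) * (indicator box4 (fst x) * indicator box4 (target z (fst x) (snd x)))) \<partial>(lborel \<Otimes>\<^sub>M lborel))"
      unfolding inner by (simp add: target_def)
    also have "\<dots> = ennreal (z\<^sup>2) * (\<integral>\<^sup>+x. ennreal (weight (fst x) * (indicator box4 (fst x) * indicator box4 (target z (fst x) (snd x)))) \<partial>(lborel \<Otimes>\<^sub>M lborel))"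
      by (rule nn_integral_cmult) measurable
    also have "(\<integral>\<^sup>+x. ennreal (weight (fst x) * (indicator box4 (fst x) * indicator box4 (target z (fst x) (snd x)))) \<partial>(lborel \<Otimes>\<^sub>M lborel)) = J z"
      unfolding J_def by (subst lborel.nn_integral_fst[symmetric]) auto
    finally show ?thesis .
  qed
  let ?B1 = "cball (0::complex) 1 \<times> cball (0::complex \<times> complex) 1"
  \<comment> \<open>A lower bound for \<open>J z\<close> uniform in
    \<open>\<bar>z\<bar> \<le> 1\<close>: on the unit balls both indicators of \<open>box4\<close>
    are 1.\<close>
  define J0 where "J0 = (\<integral>\<^sup>+p. (\<integral>\<^sup>+w. ennreal (weight p) * indicator ?B1 p * indicator (cball (0::complex \<times> complex) 1) w \<partial>lborel) \<partial>lborel)"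
  have B1_sets [measurable]: "?B1 \<in> sets borel" by (rule borel_Times) auto
  have J_ge: "J0 \<le> J z" if z: "\<bar>z\<bar> \<le> 1" for z
    unfolding J0_def J_def
  proof (intro nn_integral_mono)
    fix p :: "complex \<times> complex \<times> complex" and w :: "complex \<times> complex"
    show "ennreal (weight p) * indicator ?B1 p * indicator (cball 0 1) w \<le> ennreal (weight p * (indicator box4 p * indicator box4 (target z p w)))"
    proof (cases "p \<in> ?B1 \<and> w \<in> cball 0 1")
      case True
      then have n: "norm (fst p) \<le> 1" "norm (snd p) \<le> 1" "norm w \<le> 1" by auto
      have "norm (snd p) * norm w \<le> 1 * 1" using n by (intro mult_mono) auto
      then have "norm (bil (snd p) w) \<le> 2" using norm_bil_le[of "snd p" w] by linarith
      then have "norm (fst p + of_real z + bil (snd p) w) \<le> 4"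
        using norm_triangle_ineq[of "fst p + of_real z" "bil (snd p) w"] norm_triangle_ineq[of "fst p" "of_real z"] n z by simp
      then have "target z p w \<in> box4" "p \<in> box4"
        using n True by (auto simp: target_def box4_def)
      then show ?thesis using True by simp
    qed (auto simp: indicator_def)
  qed
  have J0_pos: "J0 > 0"
  proof -
    have "J0 = (\<integral>\<^sup>+p. ennreal (weight p) * indicator ?B1 p \<partial>lborel) * emeasure lborel (cball (0::complex \<times> complex) 1)"
    proof -
      have "J0 = (\<integral>\<^sup>+p. ennreal (weight p) * indicator ?B1 p * emeasure lborel (cball (0::complex \<times> complex) 1) \<partial>lborel)"
        unfolding J0_def by (intro nn_integral_cong nn_integral_cmult_indicator) simp
      also have "\<dots> = (\<integral>\<^sup>+p. ennreal (weight p) * indicator ?B1 p \<partial>lborel) * emeasure lborel (cball (0::complex \<times> complex) 1)"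
        using B1_sets by (intro nn_integral_multc borel_measurable_times_ennreal borel_measurable_indicator) auto
      finally show ?thesis .
    qed
    moreover have "emeasure lborel (cball (0::complex \<times> complex) 1) \<noteq> 0"
      using content_cball_pos[of 1 "0::complex \<times> complex"] by (simp add: emeasure_lborel_cball_eq)
    moreover have "(\<integral>\<^sup>+p. ennreal (weight p) * indicator ?B1 p \<partial>lborel) \<noteq> 0"
    proof
      assume "(\<integral>\<^sup>+p. ennreal (weight p) * indicator ?B1 p \<partial>lborel) = 0"
      then have "AE p in lborel. ennreal (weight p) * indicator ?B1 p = 0"
        using B1_sets by (subst (asm) nn_integral_0_iff_AE) (auto intro!: borel_measurable_times_ennreal borel_measurable_indicator)
      then have "AE p in lborel. p \<notin> ?B1"
      proof eventually_elim
        case (elim p)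
        then show ?case using weight_pos[of p] by (intro notI) (simp add: ennreal_eq_0_iff)
      qed
      then have "emeasure lborel ?B1 = 0"
        using AE_iff_null_sets[of ?B1 lborel] B1_sets by auto
      then show False
        using content_cball_pos[of 1 "0::complex"] content_cball_pos[of 1 "0::complex \<times> complex"]
        by (simp add: emeasure_lborel_cball_Times)
    qed
    ultimately show ?thesis by (simp add: zero_less_iff_neq_zero)
  qed
  \<comment> \<open>Orthogonal pairs have probability 0. In \<open>ennreal\<close> the product is 0
    even for infinite \<open>J 0\<close>. Consequently almost every \<open>l\<close> meets the
    hypothesis \<open>I 0 = 0\<close> for all messages at once.\<close>
  have "ennreal (0\<^sup>2) * J 0 = 0" by simp
  then have "(\<integral>\<^sup>+l. (\<Sum>c\<in>S. G c 0 l) \<partial>L) = 0" by (simp only: total)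
  then have "AE l in L. (\<Sum>c\<in>S. G c 0 l) = 0"
    by (subst (asm) nn_integral_0_iff_AE) auto
  then have zero: "AE l in L. \<forall>c\<in>S. G c 0 l = 0"
    by eventually_elim (use S in simp)
  define X :: "nat \<Rightarrow> real" where "X n = 1 / real (Suc n)" for n
  have X_pos: "X n > 0" and X_le: "X n \<le> 1" for n by (auto simp: X_def)
  have X_lim: "X \<longlonglongrightarrow> 0" unfolding X_def by (rule lim_1_over_n[THEN LIMSEQ_Suc])
  define Y where "Y n l = (\<Sum>c\<in>S. ennreal (1 / (X n)\<^sup>2) * (G c (X n) l + G c (- X n) l))" for n l
  \<comment> \<open>\<open>sqrt (K * M)\<close> for \<open>C = 33\<close> and \<open>R = 4\<close>,
    written out to make it visibly independent of \<open>c\<close> and \<open>l\<close>.\<close>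
  define B where "B = sqrt (33\<^sup>2 * ((2 * pi) ^ 4 * (33\<^sup>2 * (measure lborel (cball (0::complex) 4) * measure lborel (cball (0::complex \<times> complex) 4)))) * (measure lborel (cball (0::complex) 4) * measure lborel (cball (0::complex \<times> complex) 4)))"
  have "(\<lambda>n. \<integral>\<^sup>+l. Y n l \<partial>L) \<longlonglongrightarrow> (\<integral>\<^sup>+l. 0 \<partial>L)"
  proof (rule nn_integral_dominated_convergence[where w="\<lambda>_. of_nat (card S) * ennreal B"])
    show "Y n \<in> borel_measurable L" for n unfolding Y_def by measurable
    show "(\<integral>\<^sup>+l. of_nat (card S) * ennreal B \<partial>L) < \<infinity>"
      by (simp add: L.emeasure_space_1 ennreal_mult_less_top of_nat_less_top)
    show "AE l in L. Y n l \<le> of_nat (card S) * ennreal B" for n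
      using zero AE_space
    proof eventually_elim
      case (elim l)
      have "Y n l \<le> (\<Sum>c\<in>S. ennreal B)"
        unfolding Y_def
      proof (rule sum_mono)
        fix c assume c: "c \<in> S"
        interpret P: kernel_pair "cut (a c l)" "cut (b c l)" 33 4 by (rule pair[OF c elim(2)])
        have "P.I 0 = 0" using elim c by (simp flip: G_I)
        from P.I_quotient_bounded[OF this X_pos[of n]]
        show "ennreal (1 / (X n)\<^sup>2) * (G c (X n) l + G c (- X n) l) \<le> ennreal B"
          unfolding G_I[OF c elim(2)] B_def P.K_def P.M_def .
      qed
      then show ?case by simp
    qed
    show "AE l in L. (\<lambda>n. Y n l) \<longlonglongrightarrow> 0"
      using zero AE_space
    proof eventually_elim
      case (elim l)
      have "(\<lambda>n. Y n l) \<longlonglongrightarrow> (\<Sum>c\<in>S. 0)"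
        unfolding Y_def
      proof (rule tendsto_sum)
        fix c assume c: "c \<in> S"
        interpret P: kernel_pair "cut (a c l)" "cut (b c l)" 33 4 by (rule pair[OF c elim(2)])
        have "P.I 0 = 0" using elim c by (simp flip: G_I)
        from P.I_quotient_tendsto[OF this X_pos X_lim]
        show "(\<lambda>n. ennreal (1 / (X n)\<^sup>2) * (G c (X n) l + G c (- X n) l)) \<longlonglongrightarrow> 0"
          unfolding G_I[OF c elim(2)] .
      qed
      then show ?case by simp
    qed
  qed (rule borel_measurable_const)+
  then have lim: "(\<lambda>n. \<integral>\<^sup>+l. Y n l \<partial>L) \<longlonglongrightarrow> 0" by simp
  have ge: "J0 \<le> (\<integral>\<^sup>+l. Y n l \<partial>L)" for n
  proof -
    have "J0 \<le> ennreal (1 / (X n)\<^sup>2) * (ennreal ((X n)\<^sup>2) * J (X n))"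
    proof -
      have "ennreal (1 / (X n)\<^sup>2) * ennreal ((X n)\<^sup>2) = 1"
        using X_pos[of n] by (subst ennreal_mult[symmetric]) auto
      then show ?thesis using J_ge[of "X n"] X_pos[of n] X_le[of n] by (simp add: mult.assoc[symmetric])
    qed
    also have "\<dots> = ennreal (1 / (X n)\<^sup>2) * (\<integral>\<^sup>+l. (\<Sum>c\<in>S. G c (X n) l) \<partial>L)"
      by (simp only: total)
    also have "\<dots> = (\<integral>\<^sup>+l. ennreal (1 / (X n)\<^sup>2) * (\<Sum>c\<in>S. G c (X n) l) \<partial>L)"
      by (rule nn_integral_cmult[symmetric]) measurable
    \<comment> \<open>The offset \<open>X n\<close> alone gives the lower bound; the term for
      \<open>- X n\<close> is nonnegative and is only added here.\<close>
    also have "\<dots> \<le> (\<integral>\<^sup>+l. Y n l \<partial>L)"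
      unfolding Y_def sum_distrib_left by (intro nn_integral_mono sum_mono mult_left_mono) auto
    finally show ?thesis .
  qed
  have "J0 \<le> 0" by (rule LIMSEQ_le_const[OF lim]) (use ge in auto)
  with J0_pos show False by simp
qed

section \<open>States and measurements\<close>

definition herm_inner :: "complex^'d \<Rightarrow> complex^'d \<Rightarrow> complex" where
  "herm_inner x y = (\<Sum>i\<in>UNIV. cnj (x $ i) * y $ i)"

text \<open>The normalisation is built in so that vectors polynomial in their parameters can be used
  directly. By division by zero, \<open>proj 0 = 0\<close>.\<close>

definition proj :: "complex^'d \<Rightarrow> complex^'d^'d" where
  "proj x = (\<chi> i j. (1 / (norm x)\<^sup>2) *\<^sub>R (x $ i * cnj (x $ j)))"

text \<open>The test for \<open>x\<close> is outcome 1. Values beyond outcome 2 are 0, as the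
  padding in \<open>povms\<close> demands.\<close>

definition proj_povm :: "complex^'d \<Rightarrow> nat \<Rightarrow> complex^'d^'d" where
  "proj_povm x b = (if b = 1 then proj x else if b = 2 then mat 1 - proj x else 0)"

lemma norm_vec_square: "(norm x)\<^sup>2 = (\<Sum>i\<in>UNIV. (norm (x $ i))\<^sup>2)" for x :: "complex^'d"
  by (simp add: norm_vec_def L2_set_def sum_nonneg)

lemma herm_inner_self: "herm_inner x x = of_real ((norm x)\<^sup>2)"
  unfolding herm_inner_def norm_vec_square of_real_sum
  by (intro sum.cong refl) (simp only: complex_norm_square mult.commute)

lemma cnj_herm_inner: "cnj (herm_inner x y) = herm_inner y x"
  unfolding herm_inner_def by (simp add: cnj_sum mult.commute)

lemma norm_herm_inner_le: "norm (herm_inner x y) \<le> norm x * norm y"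
proof -
  have "norm (herm_inner x y) \<le> (\<Sum>i\<in>UNIV. \<bar>norm (x $ i)\<bar> * \<bar>norm (y $ i)\<bar>)"
    unfolding herm_inner_def by (rule order_trans[OF norm_sum]) (simp add: norm_mult)
  also have "\<dots> \<le> norm x * norm y"
    unfolding norm_vec_def by (rule L2_set_mult_ineq)
  finally show ?thesis .
qed

lemma proj_mult_vec: "proj x *v v = (\<chi> i. (1 / (norm x)\<^sup>2) *\<^sub>R (x $ i * herm_inner x v))"
  by (simp add: vec_eq_iff matrix_vector_mult_def proj_def herm_inner_def sum_distrib_left scaleR_conv_of_real mult_ac)

lemma proj_quadratic_form:
  "(\<Sum>i\<in>UNIV. cnj (v $ i) * (proj x *v v) $ i) = of_real ((norm (herm_inner x v))\<^sup>2 / (norm x)\<^sup>2)"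
proof -
  have "(\<Sum>i\<in>UNIV. cnj (v $ i) * (proj x *v v) $ i) = of_real (1 / (norm x)\<^sup>2) * (herm_inner v x * herm_inner x v)"
    by (simp add: proj_mult_vec herm_inner_def[of v x] sum_distrib_right sum_distrib_left scaleR_conv_of_real mult_ac)
  also have "herm_inner v x * herm_inner x v = of_real ((norm (herm_inner x v))\<^sup>2)"
    unfolding complex_norm_square cnj_herm_inner by (rule mult.commute)
  finally show ?thesis by simp
qed

lemma hermitian_proj: "hermitian_mat (proj x)"
  by (simp add: hermitian_mat_def adjoint_mat_def proj_def vec_eq_iff mult.commute)

lemma psd_proj: "psd_mat (proj x)"
  unfolding psd_mat_def proj_quadratic_form by simp

lemma hermitian_proj_complement: "hermitian_mat (mat 1 - proj x)"
  using hermitian_proj[of x] by (simp add: hermitian_mat_def adjoint_mat_def vec_eq_iff mat_def)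

text \<open>Positivity of the complement is the Cauchy-Schwarz inequality for
  \<open>herm_inner\<close>.\<close>

lemma psd_proj_complement: "psd_mat (mat 1 - proj x)"
  unfolding psd_mat_def
proof
  fix v :: "complex^'a"
  have "(\<Sum>i\<in>UNIV. cnj (v $ i) * ((mat 1 - proj x) *v v) $ i) = herm_inner v v - (\<Sum>i\<in>UNIV. cnj (v $ i) * (proj x *v v) $ i)"
    by (simp add: matrix_vector_mult_diff_rdistrib herm_inner_def right_diff_distrib sum_subtractf)
  moreover have "(norm (herm_inner x v))\<^sup>2 / (norm x)\<^sup>2 \<le> (norm v)\<^sup>2"
  proof (cases "x = 0")
    case False
    have "(norm (herm_inner x v))\<^sup>2 \<le> (norm x * norm v)\<^sup>2"
      by (intro power_mono norm_herm_inner_le) simp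
    then show ?thesis using False by (simp add: field_simps power_mult_distrib)
  qed simp
  ultimately show "0 \<le> Re (\<Sum>i\<in>UNIV. cnj (v $ i) * ((mat 1 - proj x) *v v) $ i)"
    by (simp add: proj_quadratic_form herm_inner_self)
qed

lemma trace_proj: "x \<noteq> 0 \<Longrightarrow> trace (proj x) = 1"
proof -
  assume "x \<noteq> 0"
  have "trace (proj x) = of_real (1 / (norm x)\<^sup>2) * herm_inner x x"
    by (simp add: trace_def proj_def herm_inner_def sum_distrib_left scaleR_conv_of_real mult_ac)
  then show ?thesis using \<open>x \<noteq> 0\<close> by (simp add: herm_inner_self)
qed

lemma trace_proj_mult_proj:
  "trace (proj x ** proj y) = of_real ((norm (herm_inner y x))\<^sup>2 / ((norm x)\<^sup>2 * (norm y)\<^sup>2))"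
proof -
  have "trace (proj x ** proj y) = (\<Sum>i\<in>UNIV. \<Sum>k\<in>UNIV. of_real (1 / (norm x)\<^sup>2 * (1 / (norm y)\<^sup>2)) * ((cnj (y $ i) * x $ i) * (cnj (x $ k) * y $ k)))"
    by (simp add: trace_def matrix_matrix_mult_def proj_def scaleR_conv_of_real mult_ac)
  also have "\<dots> = of_real (1 / (norm x)\<^sup>2 * (1 / (norm y)\<^sup>2)) * (herm_inner y x * herm_inner x y)"
    unfolding herm_inner_def sum_product by (simp only: sum_distrib_left)
  also have "herm_inner y x * herm_inner x y = of_real ((norm (herm_inner y x))\<^sup>2)"
    unfolding complex_norm_square cnj_herm_inner ..
  finally show ?thesis by simp
qed

lemma proj_in_states: "x \<noteq> 0 \<Longrightarrow> proj x \<in> quantum_states"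
  by (simp add: quantum_states_def hermitian_proj psd_proj trace_proj)

lemma atLeastAtMost_1_2: "{Suc 0..2} = {Suc 0, 2}"
  by auto

lemma proj_povm_in_povms: "proj_povm x \<in> povms 2"
  by (auto simp: povms_def proj_povm_def atLeastAtMost_1_2 hermitian_proj psd_proj hermitian_proj_complement psd_proj_complement)

lemma continuous_on_proj:
  assumes "continuous_on A f" "\<And>p. p \<in> A \<Longrightarrow> f p \<noteq> 0"
  shows "continuous_on A (\<lambda>p. proj (f p))"
  unfolding proj_def
  by (intro continuous_on_vec_lambda continuous_intros continuous_on_component assms) (auto simp: assms)

text \<open>Tuples carry the product topology, so continuity is checked outcome by outcome. It makes
  the parametrised measurements a Borel map.\<close>

lemma continuous_on_proj_povm:
  assumes "continuous_on A f" "\<And>p. p \<in> A \<Longrightarrow> f p \<noteq> 0"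
  shows "continuous_on A (\<lambda>p. proj_povm (f p))"
proof (rule continuous_on_coordinatewise_then_product)
  fix b
  have "continuous_on A (\<lambda>p. proj (f p))" by (rule continuous_on_proj[OF assms])
  then show "continuous_on A (\<lambda>p. proj_povm (f p) b)"
    unfolding proj_povm_def by (cases "b = 1"; cases "b = 2") (auto intro!: continuous_intros)
qed

section \<open>Vectors supported on four coordinates\<close>

definition vec4 :: "'d \<Rightarrow> 'd \<Rightarrow> 'd \<Rightarrow> 'd \<Rightarrow> complex \<Rightarrow> complex \<Rightarrow> complex \<Rightarrow> complex \<Rightarrow> complex^'d" where
  "vec4 i j k m a b c d = (\<chi> n. if n = i then a else if n = j then b else if n = k then c else if n = m then d else 0)"

lemma sum_vec4:
  fixes F :: "'d::finite \<Rightarrow> 'a::comm_monoid_add"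
  assumes "distinct [i, j, k, m]" "\<And>n. n \<notin> {i, j, k, m} \<Longrightarrow> F n = 0"
  shows "sum F UNIV = F i + (F j + (F k + F m))"
proof -
  have "sum F UNIV = sum F {i, j, k, m}"
    using assms(2) by (intro sum.mono_neutral_right) auto
  then show ?thesis using assms(1) by simp
qed

lemma norm_vec4:
  assumes "distinct [i, j, k, m]"
  shows "(norm (vec4 i j k m a b c d :: complex^'d))\<^sup>2 = (norm a)\<^sup>2 + ((norm b)\<^sup>2 + ((norm c)\<^sup>2 + (norm d)\<^sup>2))"
  unfolding norm_vec_square by (subst sum_vec4[OF assms]) (use assms in \<open>auto simp: vec4_def\<close>)

lemma herm_inner_vec4:
  assumes "distinct [i, j, k, m]"
  shows "herm_inner (vec4 i j k m a b c d :: complex^'d) (vec4 i j k m a' b' c' d') = cnj a * a' + (cnj b * b' + (cnj c * c' + cnj d * d'))"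
  unfolding herm_inner_def by (subst sum_vec4[OF assms]) (use assms in \<open>auto simp: vec4_def\<close>)

lemma continuous_on_vec4:
  assumes "continuous_on A a" "continuous_on A b" "continuous_on A c" "continuous_on A d"
  shows "continuous_on A (\<lambda>p. vec4 i j k m (a p) (b p) (c p) (d p))"
  unfolding vec4_def
proof (rule continuous_on_vec_lambda)
  fix n
  show "continuous_on A (\<lambda>p. if n = i then a p else if n = j then b p else if n = k then c p else if n = m then d p else 0)"
    by (cases "n = i"; cases "n = j"; cases "n = k"; cases "n = m") (simp_all add: assms)
qed

lemma obtain_four_distinct:
  assumes "CARD('d::finite) \<ge> 4"
  obtains i j k m :: "'d::finite" where "distinct [i, j, k, m]"
proof -
  obtain xs :: "'d list" where xs: "set xs = UNIV" "distinct xs"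
    using finite_distinct_list[OF finite[of "UNIV :: 'd set"]] by auto
  then have "Suc (Suc (Suc (Suc 0))) \<le> length xs"
    using assms distinct_card[OF xs(2)] by simp
  then obtain i j k m ys where "xs = i # j # k # m # ys"
    by (auto simp: Suc_le_length_iff)
  then have "distinct [i, j, k, m]" using xs(2) by auto
  then show ?thesis by (rule that)
qed

text \<open>Any four distinct coordinates carry the whole construction, so all dimensions from 4 on
  are treated at once, without comparing costs between dimensions.\<close>

lemma no_simulation:
  assumes "CARD('d::finite) \<ge> 4"
  shows "\<not> admits_simulation TYPE('l) TYPE('d) dC"
proof
  assume "admits_simulation TYPE('l) TYPE('d) dC"
  then obtain L :: "'l measure" and pA :: "nat \<Rightarrow> complex^'d^'d \<Rightarrow> 'l \<Rightarrow> real"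
    and pB :: "nat \<Rightarrow> nat \<Rightarrow> (nat \<Rightarrow> complex^'d^'d) \<Rightarrow> nat \<Rightarrow> 'l \<Rightarrow> real"
    where *: "prob_space L \<and> is_encoder dC L pA \<and> (\<forall>n\<ge>1. is_decoder dC L n (pB n)) \<and>
        (\<forall>n\<ge>1. \<forall>\<rho>\<in>quantum_states. \<forall>M\<in>povms n. \<forall>b\<in>{1..n}.
           trace (\<rho> ** M b) =
             complex_of_real (\<integral>l. (\<Sum>c\<in>{1..dC}. pA c \<rho> l * pB n b M c l) \<partial>L))"
    unfolding admits_simulation_def by (elim exE)
  have L: "prob_space L" and enc: "is_encoder dC L pA"
    using * by blast+
  have dec: "is_decoder dC L 2 (pB 2)"
    using * one_le_numeral by blast
  have sim: "trace (\<rho> ** M 1) = complex_of_real (\<integral>l. (\<Sum>c\<in>{1..dC}. pA c \<rho> l * pB 2 1 M c l) \<partial>L)"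
    if "\<rho> \<in> quantum_states" "M \<in> povms 2" for \<rho> M
  proof -
    have "\<forall>\<rho>\<in>quantum_states. \<forall>M\<in>povms 2. \<forall>b\<in>{1..2}.
        trace (\<rho> ** M b) = complex_of_real (\<integral>l. (\<Sum>c\<in>{1..dC}. pA c \<rho> l * pB 2 b M c l) \<partial>L)"
      using conjunct2[OF conjunct2[OF conjunct2[OF *]], rule_format, of 2] by simp
    moreover have "(1::nat) \<in> {1..2}" by simp
    ultimately show ?thesis using that by blast
  qed
  obtain i j k m :: 'd where ijkm: "distinct [i, j, k, m]"
    using obtain_four_distinct[OF assms] .
  \<comment> \<open>The entries are chosen so that the inner product becomes t - s - v \<cdot> w.
    The conjugates in \<phi> undo the conjugation in the first argument of
    \<open>herm_inner\<close>, and the entry 1 in each vector keeps it nonzero.\<close>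
  define \<psi> where "\<psi> p = vec4 i j k m 1 (- fst (snd p)) (- snd (snd p)) (- fst p)" for p :: "complex \<times> complex \<times> complex"
  define \<phi> where "\<phi> q = vec4 i j k m (cnj (fst q)) (cnj (fst (snd q))) (cnj (snd (snd q))) 1" for q :: "complex \<times> complex \<times> complex"
  have norm_triple: "(norm p)\<^sup>2 = (norm (fst p))\<^sup>2 + ((norm (fst (snd p)))\<^sup>2 + (norm (snd (snd p)))\<^sup>2)" for p :: "complex \<times> complex \<times> complex"
    by (cases p) (simp add: norm_Pair)
  have norm_\<psi>: "(norm (\<psi> p))\<^sup>2 = 1 + (norm p)\<^sup>2" and norm_\<phi>: "(norm (\<phi> p))\<^sup>2 = 1 + (norm p)\<^sup>2" for p
    unfolding \<psi>_def \<phi>_def norm_vec4[OF ijkm] norm_triple by simp_all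
  have pos: "1 + (norm p)\<^sup>2 > 0" for p :: "complex \<times> complex \<times> complex"
    by (simp add: add_pos_nonneg)
  have nz: "\<psi> p \<noteq> 0" "\<phi> p \<noteq> 0" for p
    using norm_\<psi>[of p] norm_\<phi>[of p] pos[of p] by auto
  have herm_inner_eq: "herm_inner (\<phi> q) (\<psi> p) = fst q - fst p - bil (snd p) (snd q)" for p q
    unfolding \<psi>_def \<phi>_def herm_inner_vec4[OF ijkm] by (simp add: bil_def algebra_simps)
  have cont: "continuous_on UNIV \<psi>" "continuous_on UNIV \<phi>"
    unfolding \<psi>_def \<phi>_def by (intro continuous_on_vec4 continuous_intros)+
  \<comment> \<open>Encoder and decoder are jointly measurable with the randomness; composing with
    these Borel parametrisations gives joint measurability in the parameters.\<close>
  have meas_\<psi>: "(\<lambda>p. proj (\<psi> p)) \<in> measurable borel (restrict_space borel quantum_states)"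
    by (intro measurable_restrict_space2 borel_measurable_continuous_onI continuous_on_proj cont)
       (auto simp: nz proj_in_states)
  have meas_\<phi>: "(\<lambda>p. proj_povm (\<phi> p)) \<in> measurable borel (restrict_space borel (povms 2))"
    by (intro measurable_restrict_space2 borel_measurable_continuous_onI continuous_on_proj_povm cont)
       (auto simp: nz proj_povm_in_povms)
  define a where "a c l p = pA c (proj (\<psi> p)) l" for c l p
  define b where "b c l q = pB 2 1 (proj_povm (\<phi> q)) c l" for c l q
  show False
  proof (rule no_bounded_decomposition[OF L, of "{1..dC}" a b])
    fix c assume c: "c \<in> {1..dC}"
    have "(\<lambda>(\<rho>, l). pA c \<rho> l) \<in> borel_measurable (restrict_space borel quantum_states \<Otimes>\<^sub>M L)"
      using enc c by (auto simp: is_encoder_def)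
    from measurable_compose[OF measurable_Pair[OF measurable_compose[OF measurable_snd meas_\<psi>] measurable_fst] this]
    show "(\<lambda>(l, p). a c l p) \<in> borel_measurable (L \<Otimes>\<^sub>M borel)"
      by (simp add: a_def case_prod_unfold)
    have "(\<lambda>(M, l). pB 2 1 M c l) \<in> borel_measurable (restrict_space borel (povms 2) \<Otimes>\<^sub>M L)"
      using dec c by (auto simp: is_decoder_def)
    from measurable_compose[OF measurable_Pair[OF measurable_compose[OF measurable_snd meas_\<phi>] measurable_fst] this]
    show "(\<lambda>(l, p). b c l p) \<in> borel_measurable (L \<Otimes>\<^sub>M borel)"
      by (simp add: b_def case_prod_unfold)
  next
    fix c l p assume c: "c \<in> {1..dC}" and l: "l \<in> space L"
    \<comment> \<open>The encoder is at most 1 because it sums to 1 over messages; the decoder is at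
      most 1 because it sums to 1 over the two outcomes.\<close>
    have A: "\<forall>c\<in>{1..dC}. 0 \<le> a c l p" "(\<Sum>c\<in>{1..dC}. a c l p) = 1"
      using enc l proj_in_states[OF nz(1)] by (auto simp: is_encoder_def a_def)
    then show "0 \<le> a c l p \<and> a c l p \<le> 1"
      using c member_le_sum[of c "{1..dC}" "\<lambda>c. a c l p"] by auto
    have "\<forall>b\<in>{1..2}. 0 \<le> pB 2 b (proj_povm (\<phi> p)) c l" "(\<Sum>b\<in>{1..2}. pB 2 b (proj_povm (\<phi> p)) c l) = 1"
      using dec l c proj_povm_in_povms[of "\<phi> p"] by (auto simp: is_decoder_def)
    then show "0 \<le> b c l p \<and> b c l p \<le> 1"
      by (auto simp: b_def atLeastAtMost_1_2)
  next
    fix p q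
    have "complex_of_real (\<integral>l. (\<Sum>c\<in>{1..dC}. a c l p * b c l q) \<partial>L) = trace (proj (\<psi> p) ** proj (\<phi> q))"
      unfolding a_def b_def by (subst sim[symmetric]) (auto simp: proj_in_states nz proj_povm_in_povms proj_povm_def)
    also have "\<dots> = of_real ((norm (fst q - fst p - bil (snd p) (snd q)))\<^sup>2 / ((1 + (norm p)\<^sup>2) * (1 + (norm q)\<^sup>2)))"
      unfolding trace_proj_mult_proj norm_\<psi> norm_\<phi> herm_inner_eq ..
    finally show "(\<integral>l. (\<Sum>c\<in>{1..dC}. a c l p * b c l q) \<partial>L)
        = (norm (fst q - fst p - bil (snd p) (snd q)))\<^sup>2 / ((1 + (norm p)\<^sup>2) * (1 + (norm q)\<^sup>2))"
      by (simp only: of_real_eq_iff)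
  qed simp
qed

lemma classical_cost_infinite:
  assumes "CARD('d::finite) \<ge> 4"
  shows "classical_cost TYPE('l) TYPE('d) = \<infinity>"
  using no_simulation[OF assms, where 'l='l] by (simp add: classical_cost_def top_enat_def)

theorem theoremB1:
  shows "classical_cost TYPE('l) TYPE(4) = \<infinity> \<and>
    (CARD('d::finite) \<ge> 4 \<longrightarrow> classical_cost TYPE('l) TYPE('d) = \<infinity>)"
  by (simp add: classical_cost_infinite)

end
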